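(* Let $\Theta\subset\mathbb{R}^d$ be compact and let $\{\nu_\theta\}_{\theta\in\Theta}$ be a family of probability distributions on $(0,1)$. Assume that for every $\theta\in\Theta$, $\mathbb{E}^\theta|\log\rho_0|<\infty$ and $\mathbb{E}^\theta(\log\rho_0)<0$. Then for all $\theta\in\Theta$ the following assertions hold for the branching process in random environment $\{Z_n\}_{n\in\mathbb{N}}$ under the annealed law $\mathbf{P}^\theta$. i) The Markov chain $\{Z_n\}_{n\in\mathbb{N}}$ is positive recurrent and admits a unique invariant probability measure $\pi_\theta$, which satisfies $$\lim_{n\to\infty}\mathbf{P}^\theta(Z_n=k)=\pi_\theta(k),\qquad\forall k\in\mathbb{N}.$$ ii) Moreover, for all $k\in\mathbb{N}$, $\pi_\theta(k)=\mathbb{E}^\theta[S(1-S)^k]$, where $$S:=(1+\rho_1+\rho_1\rho_2+\dots+\rho_1\cdots\rho_n+\cdots)^{-1}\in(0,1).$$ In particular, $\sum_{k\in\mathbb{N}}k\,\pi_\theta(k)=\sum_{n\ge1}(\mathbb{E}^\theta\rho_0)^n$ (as elements of $[0,+\infty]$), and the distribution $\pi_\theta$ has a finite first order moment only in the ballistic case, that is, when $\mathbb{E}^\theta(\rho_0)<1$.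
   Context: $\mathbb{N}=\{0,1,2,\dots\}$. For $\theta\in\Theta$, $\mathbb{P}^\theta=\nu_\theta^{\otimes\mathbb{Z}}$ is the law on $(0,1)^{\mathbb{Z}}$ of an i.i.d. environment $\omega=\{\omega_x\}_{x\in\mathbb{Z}}$ with marginal $\nu_\theta$, with expectation $\mathbb{E}^\theta$, and $\rho_x=(1-\omega_x)/\omega_x$. Given $\omega$, under the quenched law $P_\omega$, let $\{\xi'_{k,i}\}_{k\ge1,\,i\in\mathbb{N}}$ be independent with $P_\omega(\xi'_{k,i}=m)=(1-\omega_k)^m\omega_k$ for $m\in\mathbb{N}$, and define $$Z_0=0,\qquad Z_{k+1}=\sum_{i=0}^{Z_k}\xi'_{k+1,i},\quad k\ge0$$ (a branching process with geometric offspring and one immigrant per generation). The annealed law is $\mathbf{P}^\theta(\cdot)=\int P_\omega(\cdot)\,d\mathbb{P}^\theta(\omega)$. Under $\mathbf{P}^\theta$, $\{Z_n\}_{n\in\mathbb{N}}$ is a homogeneous Markov chain on $\mathbb{N}$ with transition kernel $$Q_\theta(x,y)=\binom{x+y}{x}\int_0^1a^{x+1}(1-a)^y\,d\nu_\theta(a),\qquad x,y\in\mathbb{N}.$$ *)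

theory Defs
  imports "HOL-Probability.Probability"
begin

text \<open>
  A marginal is a measure \<open>\<nu>\<close> whose underlying space is the open interval (0,1) with its Borel
  sets, so that \<open>env_law \<nu>\<close> lives on the set of environments indexed by all integers and with
  values in (0,1).
\<close>

definition distribution_01 :: "real measure \<Rightarrow> bool" where
  "distribution_01 \<nu> \<longleftrightarrow> prob_space \<nu> \<and> sets \<nu> = sets (restrict_space borel {0<..<1})"

definition env_law :: "real measure \<Rightarrow> (int \<Rightarrow> real) measure" where
  "env_law \<nu> = PiM UNIV (\<lambda>_. \<nu>)"

definition rho :: "(int \<Rightarrow> real) \<Rightarrow> int \<Rightarrow> real" where
  "rho \<omega> x = (1 - \<omega> x) / \<omega> x"

text \<open>
  Under the quenched law the offspring variables are the coordinates of an element of a product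
  space indexed by the pairs \<open>(k, i)\<close> with \<open>k \<ge> 1\<close>. The library's \<open>geometric_pmf p\<close> is the
  distribution on the natural numbers, including 0, with weights \<open>(1 - p) ^ m * p\<close>.
\<close>

definition quenched_law :: "(int \<Rightarrow> real) \<Rightarrow> (nat \<times> nat \<Rightarrow> nat) measure" where
  "quenched_law \<omega> = PiM ({1..} \<times> UNIV) (\<lambda>(k, i). measure_pmf (geometric_pmf (\<omega> (int k))))"

definition annealed_law :: "real measure \<Rightarrow> (nat \<times> nat \<Rightarrow> nat) measure" where
  "annealed_law \<nu> = env_law \<nu> \<bind> quenched_law"

text \<open>
  The quenched law is a measurable kernel, so that the monadic bind in \<open>annealed_law\<close> is indeed
  the mixture of the quenched laws; see \<open>emeasure_annealed_law\<close>.
\<close>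

lemma measurable_emeasure_geometric: "(\<lambda>p. emeasure (measure_pmf (geometric_pmf p)) E) \<in> borel_measurable (restrict_space borel {0<..<1})"
proof -
  have "(\<lambda>p. \<Sum>n. ennreal ((1 - p) ^ n * p) * indicator E n) \<in> borel_measurable (restrict_space borel {0<..<1::real})"
  proof -
    have [measurable]: "(\<lambda>p. p) \<in> borel_measurable (restrict_space borel {0<..<1::real})" by (auto intro: measurable_restrict_space1)
    have [measurable]: "(\<lambda>p. indicator E n :: ennreal) \<in> borel_measurable (restrict_space borel {0<..<1::real})" for n by (rule measurable_const) simp
    show ?thesis by measurable
  qed
  moreover have "emeasure (measure_pmf (geometric_pmf p)) E = (\<Sum>n. ennreal ((1 - p) ^ n * p) * indicator E n)" if "p \<in> {0<..<1}" for p
    using that by (subst nn_integral_indicator[symmetric], simp, subst nn_integral_measure_pmf, simp add: nn_integral_count_space_nat)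
  ultimately show ?thesis by (subst measurable_cong[where g="\<lambda>p. \<Sum>n. ennreal ((1 - p) ^ n * p) * indicator E n"]) (auto simp: space_restrict_space)
qed

lemma measurable_quenched_law:
  assumes "distribution_01 \<nu>"
  shows "quenched_law \<in> env_law \<nu> \<rightarrow>\<^sub>M subprob_algebra (PiM ({1..} \<times> UNIV) (\<lambda>_. count_space UNIV))"
proof -
  let ?I = "{1..} \<times> UNIV :: (nat\<times>nat) set"
  let ?M = "\<lambda>_::nat\<times>nat. count_space (UNIV::nat set)"
  have s: "sets \<nu> = sets (restrict_space borel {0<..<1})" using assms by (simp add: distribution_01_def)
  have pr: "prob_space (quenched_law w)" for w
    unfolding quenched_law_def by (rule prob_space_PiM) (auto split: prod.split simp: measure_pmf.prob_space_axioms)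
  have st: "sets (quenched_law w) = sets (PiM ?I ?M)" for w
    unfolding quenched_law_def by (rule sets_PiM_cong) (auto split: prod.split)
  show ?thesis
  proof (rule measurable_subprob_algebra_generated[where \<Omega>="\<Pi>\<^sub>E i\<in>?I. space (?M i)" and G="prod_algebra ?I ?M"])
    show "sets (PiM ?I ?M) = sigma_sets (\<Pi>\<^sub>E i\<in>?I. space (?M i)) (prod_algebra ?I ?M)" by (rule sets_PiM)
    show "Int_stable (prod_algebra ?I ?M)" by (rule Int_stable_prod_algebra)
    show "prod_algebra ?I ?M \<subseteq> Pow (\<Pi>\<^sub>E i\<in>?I. space (?M i))" by (rule prod_algebra_sets_into_space)
    show "subprob_space (quenched_law w)" for w using pr by (rule prob_space_imp_subprob_space)
    show "sets (quenched_law w) = sets (PiM ?I ?M)" for w by (rule st)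
    show "(\<lambda>w. emeasure (quenched_law w) (\<Pi>\<^sub>E i\<in>?I. space (?M i))) \<in> borel_measurable (env_law \<nu>)"
    proof -
      have "space (quenched_law w) = (\<Pi>\<^sub>E i\<in>?I. space (?M i))" for w
        using sets_eq_imp_space_eq[OF st[of w]] by (simp add: space_PiM)
      then have "emeasure (quenched_law w) (\<Pi>\<^sub>E i\<in>?I. space (?M i)) = 1" for w
        using prob_space.emeasure_space_1[OF pr[of w]] by simp
      then show ?thesis by simp
    qed
    fix A assume "A \<in> prod_algebra ?I ?M"
    then obtain J E where J: "A = prod_emb ?I ?M J (Pi\<^sub>E J E)" "finite J" "J \<subseteq> ?I" 
      by (auto elim!: prod_algebraE)
    have "emeasure (quenched_law w) A = (\<Prod>j\<in>J. emeasure (measure_pmf (geometric_pmf (w (int (fst j))))) (E j))" for w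
    proof -
      interpret product_prob_space "\<lambda>(k, i::nat). measure_pmf (geometric_pmf (w (int k)))" ?I
        by (rule product_prob_spaceI) (auto split: prod.split simp: measure_pmf.prob_space_axioms)
      have "A = prod_emb ?I (\<lambda>(k, i::nat). measure_pmf (geometric_pmf (w (int k)))) J (Pi\<^sub>E J E)"
        unfolding J prod_emb_def by (auto split: prod.split)
      then have "emeasure (quenched_law w) A = (\<Prod>j\<in>J. emeasure ((\<lambda>(k, i::nat). measure_pmf (geometric_pmf (w (int k)))) j) (E j))"
        unfolding quenched_law_def using emeasure_PiM_emb[OF J(3,2), of E] by (simp add: split_beta)
      then show ?thesis by (simp add: split_beta)
    qed
    moreover have "(\<lambda>w. \<Prod>j\<in>J. emeasure (measure_pmf (geometric_pmf (w (int (fst j))))) (E j)) \<in> borel_measurable (env_law \<nu>)"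
    proof (rule borel_measurable_prod_ennreal)
      fix j :: "nat \<times> nat"
      have "(\<lambda>w. w (int (fst j))) \<in> env_law \<nu> \<rightarrow>\<^sub>M restrict_space borel {0<..<1}"
        unfolding env_law_def by (subst measurable_cong_sets[OF refl s[symmetric]]) (rule measurable_component_singleton, simp)
      from measurable_compose[OF this measurable_emeasure_geometric]
      show "(\<lambda>w. emeasure (measure_pmf (geometric_pmf (w (int (fst j))))) (E j)) \<in> borel_measurable (env_law \<nu>)" .
    qed
    ultimately show "(\<lambda>w. emeasure (quenched_law w) A) \<in> borel_measurable (env_law \<nu>)" by simp
  qed
qed

lemma emeasure_annealed_law:
  assumes \<nu>: "distribution_01 \<nu>"
    and A: "A \<in> sets (PiM ({1..} \<times> UNIV) (\<lambda>_. count_space UNIV))"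
  shows "emeasure (annealed_law \<nu>) A = (\<integral>\<^sup>+ \<omega>. emeasure (quenched_law \<omega>) A \<partial>env_law \<nu>)"
proof -
  have "prob_space (env_law \<nu>)"
    unfolding env_law_def using \<nu> by (intro prob_space_PiM) (simp add: distribution_01_def)
  then have "space (env_law \<nu>) \<noteq> {}" by (rule prob_space.not_empty)
  then show ?thesis
    unfolding annealed_law_def by (rule emeasure_bind[OF _ measurable_quenched_law[OF \<nu>] A])
qed

text \<open>
  The initial value \<open>z\<close> is a parameter, because positive recurrence refers to the chain started
  from an arbitrary state. The process of the theorem is \<open>branching 0\<close>. The sum has
  \<open>Z\<^sub>k + 1\<close> terms, the additional one being the immigrant.
\<close>

primrec branching :: "nat \<Rightarrow> (nat \<times> nat \<Rightarrow> nat) \<Rightarrow> nat \<Rightarrow> nat" where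
  "branching z \<xi> 0 = z"
| "branching z \<xi> (Suc k) = (\<Sum>i = 0..branching z \<xi> k. \<xi> (Suc k, i))"

text \<open>The infimum of the empty set is \<open>\<infinity>\<close>.\<close>

definition return_time :: "(nat \<Rightarrow> 'a) \<Rightarrow> 'a \<Rightarrow> ennreal" where
  "return_time X x = (INF n\<in>{n. n \<ge> 1 \<and> X n = x}. of_nat n)"

text \<open>
  Every state is positive recurrent: started from \<open>x\<close>, the chain has a finite expected return
  time to \<open>x\<close> (so that, in particular, it returns to \<open>x\<close> almost surely).
\<close>

definition positive_recurrent :: "real measure \<Rightarrow> bool" where
  "positive_recurrent \<nu> \<longleftrightarrow>
     (\<forall>x. (\<integral>\<^sup>+ \<xi>. return_time (branching x \<xi>) x \<partial>annealed_law \<nu>) < \<infinity>)"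

definition Q_kernel :: "real measure \<Rightarrow> nat \<Rightarrow> nat \<Rightarrow> real" where
  "Q_kernel \<nu> x y = real ((x + y) choose x) * (\<integral>a. a ^ (x + 1) * (1 - a) ^ y \<partial>\<nu>)"

definition invariant_pmf :: "(nat \<Rightarrow> nat \<Rightarrow> real) \<Rightarrow> nat pmf \<Rightarrow> bool" where
  "invariant_pmf Q p \<longleftrightarrow> (\<forall>y. (\<lambda>x. pmf p x * Q x y) sums pmf p y)"

text \<open>
  The series is evaluated in \<open>[0, \<infinity>]\<close>, so that \<open>S_env \<omega> = 0\<close> when it diverges; hence
  \<open>0 < S_env \<omega>\<close> says precisely that it converges.
\<close>

definition S_env :: "(int \<Rightarrow> real) \<Rightarrow> real" where
  "S_env \<omega> = enn2real (inverse (\<Sum>n. ennreal (\<Prod>j = 1..n. rho \<omega> (int j))))"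

end

theory Submission
  imports Defs
begin

text \<open>
  Fix one marginal \<open>\<nu>\<close>. Everything rests on one quenched computation
  (\<open>bind_geometric_neg_binomial\<close>): if \<open>Z\<^sub>n\<close> is geometric with parameter \<open>p\<close> and the next environment
  value is \<open>a\<close>, then \<open>Z\<^sub>n\<^sub>+\<^sub>1\<close> is again geometric, with parameter \<open>p'\<close> given by
  \<open>1 / p' = 1 + ((1 - a) / a) * (1 / p)\<close>. Starting from 0, that is from \<open>p = 1\<close>, the quenched law of
  \<open>Z\<^sub>n\<close> is therefore geometric, and \<open>1 / p\<close> is a partial sum of the series
  \<open>1 + \<rho>\<^sub>1 + \<rho>\<^sub>1 \<rho>\<^sub>2 + \<dots>\<close> in which the newest environment value plays the part of \<open>\<rho>\<^sub>1\<close>. As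
  the environment is i.i.d., this reversal of its order does not change annealed probabilities:
  \<open>P(Z\<^sub>n = k) = E[S\<^sub>n (1 - S\<^sub>n) ^ k]\<close> with \<open>1 / S\<^sub>n\<close> the \<open>n\<close>-th partial sum
  (\<open>ennreal_pmf_step_law_0\<close>). Since \<open>S\<^sub>n\<close> decreases to \<open>S\<close>, dominated convergence gives the limit
  \<open>E[S (1 - S) ^ k]\<close> (\<open>step_law_0_tendsto\<close>). The same computation, applied to
  \<open>1 / S = 1 + \<rho>\<^sub>1 * (1 / S')\<close> with \<open>S'\<close> the value of \<open>S\<close> in the shifted environment, shows that the
  limit is invariant (\<open>bind_stationary_K\<close>).

  These weights sum to \<open>P(S > 0)\<close>, so the series has to converge almost surely. Its terms are the
  exponentials of a random walk with negative drift \<open>E log \<rho>\<close>, so it is enough that the walk with half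
  of its drift removed is bounded above. This is \<open>AE_walk_bounded_above\<close>, proved by the idea of the
  maximal ergodic lemma and without a law of large numbers.

  All transition probabilities are positive. This makes the invariant distribution unique
  (\<open>invariant_pmf_unique\<close>). Also \<open>P(Z\<^sub>n = 0) \<ge> E S > 0\<close> for all \<open>n\<close>, so the probability of being back
  in the initial state at time \<open>n\<close> is bounded below for \<open>n \<ge> 2\<close>; a decomposition at the last visit
  turns such a bound into a finite mean return time (\<open>suminf_avoid_prob_finite\<close>). Finally, a geometric
  variable with parameter \<open>S\<close> has mean \<open>1 / S - 1 = \<rho>\<^sub>1 + \<rho>\<^sub>1 \<rho>\<^sub>2 + \<dots>\<close>, whose expectation is the
  geometric series of \<open>E \<rho>\<close> (\<open>mean_stationary\<close>).

  That the process \<open>branching\<close> under \<open>annealed_law\<close> is the Markov chain with kernel \<open>Q_kernel\<close> is the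
  content of \<open>emeasure_annealed_path\<close> and \<open>distr_history\<close>.
\<close>

section \<open>The annealed transition kernel\<close>

text \<open>
  The number of children in a generation with \<open>x\<close> parents and one immigrant is negative binomial with
  parameters \<open>x + 1\<close> and \<open>a\<close>. Put \<open>q = 1 - (1 - p) * a\<close>. The product of the two weights at \<open>x\<close> and
  \<open>y\<close> is, up to a factor that depends only on \<open>y\<close>, the weight at \<open>x\<close> of the negative binomial
  distribution with parameters \<open>y + 1\<close> and \<open>q\<close>, so the sum over \<open>x\<close> needs no binomial series.
\<close>

lemma bind_geometric_neg_binomial:
  fixes p a :: real
  assumes p: "0 < p" "p \<le> 1" and a: "0 < a" "a < 1"
  shows "bind_pmf (geometric_pmf p) (\<lambda>x. neg_binomial_pmf (Suc x) a)
    = geometric_pmf (inverse (1 + (1 - a) / a * inverse p))"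
proof (rule pmf_eqI)
  fix y
  let ?q = "1 - (1 - p) * a"
  let ?p' = "inverse (1 + (1 - a) / a * inverse p)"
  have q: "0 < ?q" "?q \<le> 1"
  proof -
    have "(1 - p) * a \<le> 1 * a" using p a by (intro mult_right_mono) auto
    then show "0 < ?q" using a by linarith
    show "?q \<le> 1" using p a by simp
  qed
  have p': "?p' = p * a / ?q"
    using p a q by (simp add: field_simps)
  have "p * a \<le> ?q" using a by (simp add: algebra_simps)
  then have p'_bounds: "0 < ?p'" "?p' \<le> 1" using p a q unfolding p' by simp_all
  have "ennreal (pmf (bind_pmf (geometric_pmf p) (\<lambda>x. neg_binomial_pmf (Suc x) a)) y)
      = (\<integral>\<^sup>+x. ennreal (pmf (geometric_pmf p) x) * ennreal (pmf (neg_binomial_pmf (Suc x) a) y) \<partial>count_space UNIV)"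
    by (simp add: ennreal_pmf_bind nn_integral_measure_pmf)
  also have "\<dots> = (\<integral>\<^sup>+x. ennreal (p * a * (1 - a) ^ y / ?q ^ Suc y) * ennreal (pmf (neg_binomial_pmf (Suc y) ?q) x) \<partial>count_space UNIV)"
  proof (rule nn_integral_cong)
    fix x :: nat
    have "pmf (geometric_pmf p) x * pmf (neg_binomial_pmf (Suc x) a) y
      = p * a * (1 - a) ^ y / ?q ^ Suc y * pmf (neg_binomial_pmf (Suc y) ?q) x"
    proof -
      have "pmf (neg_binomial_pmf (Suc y) ?q) x = real (x + y choose x) * ?q ^ Suc y * ((1 - p) ^ x * a ^ x)"
        using q by (simp add: pmf_neg_binomial flip: power_mult_distrib)
      moreover have "?q ^ Suc y \<noteq> 0" using q by simp
      ultimately have "p * a * (1 - a) ^ y / ?q ^ Suc y * pmf (neg_binomial_pmf (Suc y) ?q) x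
          = p * a * (1 - a) ^ y * (real (x + y choose x) * ((1 - p) ^ x * a ^ x))"
        by (simp del: power_Suc)
      also have "\<dots> = pmf (geometric_pmf p) x * pmf (neg_binomial_pmf (Suc x) a) y"
        using p a binomial_symmetric[of x "x + y"]
        by (simp add: pmf_neg_binomial add.commute mult_ac)
      finally show ?thesis ..
    qed
    then show "ennreal (pmf (geometric_pmf p) x) * ennreal (pmf (neg_binomial_pmf (Suc x) a) y)
      = ennreal (p * a * (1 - a) ^ y / ?q ^ Suc y) * ennreal (pmf (neg_binomial_pmf (Suc y) ?q) x)"
      using p a q by (subst (1 2) ennreal_mult[symmetric]) auto
  qed
  also have "\<dots> = ennreal (p * a * (1 - a) ^ y / ?q ^ Suc y)"
    by (subst nn_integral_cmult) (simp_all add: nn_integral_pmf)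
  also have "p * a * (1 - a) ^ y / ?q ^ Suc y = (1 - ?p') ^ y * ?p'"
  proof -
    have "1 - ?p' = (1 - a) / ?q" using q unfolding p' by (simp add: field_simps)
    then show ?thesis unfolding p' by (simp add: power_divide mult_ac)
  qed
  also have "\<dots> = pmf (geometric_pmf ?p') y"
    using p'_bounds by simp
  finally show "pmf (bind_pmf (geometric_pmf p) (\<lambda>x. neg_binomial_pmf (Suc x) a)) y = pmf (geometric_pmf ?p') y"
    by (simp add: p'_bounds)
qed

locale env_marginal =
  fixes \<nu> :: "real measure"
  assumes distribution_01: "distribution_01 \<nu>"
begin

lemma prob_space_marginal: "prob_space \<nu>"
  using distribution_01 by (simp add: distribution_01_def)

sublocale prob_space \<nu>
  by (rule prob_space_marginal)

lemma sets_marginal: "sets \<nu> = sets (restrict_space borel {0<..<1})"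
  using distribution_01 by (simp add: distribution_01_def)

lemma space_marginal: "space \<nu> = {0<..<1}"
  using sets_eq_imp_space_eq[OF sets_marginal] by (simp add: space_restrict_space)

lemma measurable_marginal_id [measurable]: "(\<lambda>a. a) \<in> borel_measurable \<nu>"
  unfolding measurable_cong_sets[OF sets_marginal refl]
  by (auto intro: measurable_restrict_space1)

lemma pmf_neg_binomial_in_range:
  "a \<in> space \<nu> \<Longrightarrow> pmf (neg_binomial_pmf (Suc x) a) y = real ((x + y) choose x) * (a ^ (x + 1) * (1 - a) ^ y)"
  using binomial_symmetric[of x "x + y"]
  by (simp add: space_marginal pmf_neg_binomial add.commute)

lemma measurable_pmf_neg_binomial [measurable]:
  "(\<lambda>a. pmf (neg_binomial_pmf (Suc x) a) y) \<in> borel_measurable \<nu>"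
  by (subst measurable_cong[OF pmf_neg_binomial_in_range]) measurable

lemma Q_kernel_eq: "Q_kernel \<nu> x y = (\<integral>a. pmf (neg_binomial_pmf (Suc x) a) y \<partial>\<nu>)"
  unfolding Q_kernel_def
  by (subst Bochner_Integration.integral_mult_right_zero[symmetric])
     (intro Bochner_Integration.integral_cong refl pmf_neg_binomial_in_range[symmetric])

lemma integrable_pmf_neg_binomial: "integrable \<nu> (\<lambda>a. pmf (neg_binomial_pmf (Suc x) a) y)"
  by (rule integrable_const_bound[where B=1]) (auto simp: pmf_le_1)

lemma ennreal_Q_kernel: "ennreal (Q_kernel \<nu> x y) = (\<integral>\<^sup>+a. pmf (neg_binomial_pmf (Suc x) a) y \<partial>\<nu>)"
  unfolding Q_kernel_eq by (rule nn_integral_eq_integral[symmetric]) (auto intro: integrable_pmf_neg_binomial)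

lemma Q_kernel_nonneg: "0 \<le> Q_kernel \<nu> x y"
  unfolding Q_kernel_eq by (intro Bochner_Integration.integral_nonneg) simp

lemma Q_kernel_pos: "0 < Q_kernel \<nu> x y"
proof -
  have "0 < pmf (neg_binomial_pmf (Suc x) a) y" if "a \<in> space \<nu>" for a
    using that by (simp add: pmf_neg_binomial_in_range) (simp add: space_marginal)
  then have "AE a in \<nu>. 0 < pmf (neg_binomial_pmf (Suc x) a) y" by (rule AE_I2)
  then have "(\<integral>a. 0 \<partial>\<nu>) < (\<integral>a. pmf (neg_binomial_pmf (Suc x) a) y \<partial>\<nu>)"
    by (intro integral_less_AE_space integrable_pmf_neg_binomial) (simp_all add: emeasure_space_1)
  then show ?thesis unfolding Q_kernel_eq by simp
qed

definition K :: "nat \<Rightarrow> nat pmf" where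
  "K x = embed_pmf (Q_kernel \<nu> x)"

lemma pmf_K: "pmf (K x) y = Q_kernel \<nu> x y"
  unfolding K_def
proof (rule pmf_embed_pmf)
  have "(\<integral>\<^sup>+ y. ennreal (Q_kernel \<nu> x y) \<partial>count_space UNIV)
      = (\<integral>\<^sup>+ a. (\<integral>\<^sup>+ y. pmf (neg_binomial_pmf (Suc x) a) y \<partial>count_space UNIV) \<partial>\<nu>)"
    unfolding ennreal_Q_kernel by (simp add: nn_integral_count_space_nat nn_integral_suminf)
  also have "\<dots> = 1"
    by (simp add: nn_integral_pmf emeasure_space_1)
  finally show "(\<integral>\<^sup>+ y. ennreal (Q_kernel \<nu> x y) \<partial>count_space UNIV) = 1" .
qed (rule Q_kernel_nonneg)

lemma ennreal_pmf_K: "ennreal (pmf (K x) y) = (\<integral>\<^sup>+a. pmf (neg_binomial_pmf (Suc x) a) y \<partial>\<nu>)"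
  unfolding pmf_K by (rule ennreal_Q_kernel)

text \<open>
  The quenched computation, averaged: one step of the annealed chain from a mixture of geometric laws with
  random parameter \<open>G\<close> gives such a mixture again, with an independent environment value \<open>a\<close> entering
  the new parameter. This serves both for the law at time \<open>n\<close>, where \<open>G\<close> is the reciprocal of a partial
  sum, and for the invariant law, where it is \<open>S\<close>; only in the second case is \<open>G > 0\<close> an almost sure
  statement.
\<close>

lemma bind_geometric_mixture_K:
  fixes N :: "'b measure" and G :: "'b \<Rightarrow> real"
  assumes "prob_space N" and G [measurable]: "G \<in> borel_measurable N"
    and G_range: "AE \<eta> in N. 0 < G \<eta> \<and> G \<eta> \<le> 1"
    and p: "\<And>x. ennreal (pmf p x) = (\<integral>\<^sup>+\<eta>. ennreal (G \<eta> * (1 - G \<eta>) ^ x) \<partial>N)"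
  shows "ennreal (pmf (bind_pmf p K) y)
    = (\<integral>\<^sup>+a. \<integral>\<^sup>+\<eta>. (let g = inverse (1 + (1 - a) / a * inverse (G \<eta>)) in ennreal (g * (1 - g) ^ y)) \<partial>N \<partial>\<nu>)"
proof -
  interpret N: prob_space N by fact
  have "ennreal (pmf (bind_pmf p K) y)
      = (\<Sum>x. (\<integral>\<^sup>+\<eta>. ennreal (G \<eta> * (1 - G \<eta>) ^ x) \<partial>N) * (\<integral>\<^sup>+a. pmf (neg_binomial_pmf (Suc x) a) y \<partial>\<nu>))"
    by (simp add: ennreal_pmf_bind nn_integral_measure_pmf nn_integral_count_space_nat p ennreal_pmf_K)
  also have "\<dots> = (\<Sum>x. \<integral>\<^sup>+a. \<integral>\<^sup>+\<eta>. ennreal (G \<eta> * (1 - G \<eta>) ^ x) * pmf (neg_binomial_pmf (Suc x) a) y \<partial>N \<partial>\<nu>)"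
    by (simp add: nn_integral_multc nn_integral_cmult)
  also have "\<dots> = (\<integral>\<^sup>+a. \<integral>\<^sup>+\<eta>. (\<Sum>x. ennreal (G \<eta> * (1 - G \<eta>) ^ x) * pmf (neg_binomial_pmf (Suc x) a) y) \<partial>N \<partial>\<nu>)"
    by (subst nn_integral_suminf[symmetric], measurable)
       (intro nn_integral_cong, subst nn_integral_suminf, measurable)
  also have "\<dots> = (\<integral>\<^sup>+a. \<integral>\<^sup>+\<eta>. (let g = inverse (1 + (1 - a) / a * inverse (G \<eta>)) in ennreal (g * (1 - g) ^ y)) \<partial>N \<partial>\<nu>)"
  proof (rule nn_integral_cong, rule nn_integral_cong_AE)
    fix a assume "a \<in> space \<nu>"
    then have a: "0 < a" "a < 1" by (auto simp: space_marginal)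
    show "AE \<eta> in N. (\<Sum>x. ennreal (G \<eta> * (1 - G \<eta>) ^ x) * pmf (neg_binomial_pmf (Suc x) a) y)
       = (let g = inverse (1 + (1 - a) / a * inverse (G \<eta>)) in ennreal (g * (1 - g) ^ y))"
      using G_range
    proof eventually_elim
      case (elim \<eta>)
      define g where "g = inverse (1 + (1 - a) / a * inverse (G \<eta>))"
      have "1 \<le> 1 + (1 - a) / a * inverse (G \<eta>)" using elim a by simp
      then have g: "0 < g" "g \<le> 1" unfolding g_def by (simp_all add: inverse_le_1_iff del: le_add_same_cancel1)
      have "(\<Sum>x. ennreal (G \<eta> * (1 - G \<eta>) ^ x) * pmf (neg_binomial_pmf (Suc x) a) y)
          = ennreal (pmf (bind_pmf (geometric_pmf (G \<eta>)) (\<lambda>x. neg_binomial_pmf (Suc x) a)) y)"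
        using elim by (simp add: ennreal_pmf_bind nn_integral_measure_pmf nn_integral_count_space_nat mult.commute)
      also have "\<dots> = ennreal (g * (1 - g) ^ y)"
        using elim a g bind_geometric_neg_binomial[of "G \<eta>" a]
        by (simp only: g_def[symmetric] pmf_geometric mult.commute[of _ g])
      finally show ?case by (simp add: g_def Let_def)
    qed
  qed
  finally show ?thesis .
qed

end

section \<open>Random walks with negative drift\<close>

context env_marginal
begin

abbreviation env_seq :: "(nat \<Rightarrow> real) measure" where
  "env_seq \<equiv> PiM UNIV (\<lambda>_. \<nu>)"

sublocale seq: sequence_space \<nu> ..

lemma distr_env_seq_shift: "distr env_seq env_seq (\<lambda>\<eta> n. \<eta> (Suc n)) = env_seq"
  using distr_PiM_reindex[of UNIV "\<lambda>_. \<nu>" Suc "UNIV :: nat set", OF prob_space_marginal inj_Suc]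
  by (simp only: restrict_UNIV Pi_UNIV UNIV_I simp_thms)

lemma distr_env_law_shift: "distr (env_law \<nu>) env_seq (\<lambda>\<omega> n. \<omega> (int (Suc n))) = env_seq"
proof -
  have "inj (\<lambda>n. int (Suc n))" by (simp add: inj_on_def)
  from distr_PiM_reindex[of UNIV "\<lambda>_. \<nu>" "\<lambda>n. int (Suc n)" "UNIV :: nat set", OF prob_space_marginal this]
  show ?thesis by (simp only: env_law_def restrict_UNIV Pi_UNIV UNIV_I simp_thms)
qed

lemma measurable_env_seq_component [measurable]: "(\<lambda>\<eta>. \<eta> n) \<in> env_seq \<rightarrow>\<^sub>M \<nu>"
  by (rule measurable_component_singleton) simp

lemma measurable_env_seq_shift: "(\<lambda>\<eta> n. \<eta> (Suc n)) \<in> env_seq \<rightarrow>\<^sub>M env_seq"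
  by (rule measurable_PiM_single') (auto simp: space_PiM PiE_iff)

lemma measurable_case_nat_env:
  "(\<lambda>(a, \<eta>). case_nat a \<eta>) \<in> \<nu> \<Otimes>\<^sub>M env_seq \<rightarrow>\<^sub>M env_seq"
  by measurable

lemma space_env_seq: "\<eta> \<in> space env_seq \<longleftrightarrow> (\<forall>n. 0 < \<eta> n \<and> \<eta> n < 1)"
  by (auto simp: space_PiM PiE_iff space_marginal)

text \<open>
  Conditioning on the first coordinate. As the tail has the same law as the whole sequence, this is the
  form in which the i.i.d. structure of the environment enters the recursions below.
\<close>

lemma nn_integral_env_seq:
  assumes [measurable]: "f \<in> borel_measurable env_seq"
  shows "(\<integral>\<^sup>+\<eta>. f \<eta> \<partial>env_seq) = (\<integral>\<^sup>+a. \<integral>\<^sup>+\<eta>. f (case_nat a \<eta>) \<partial>env_seq \<partial>\<nu>)"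
proof -
  have "(\<integral>\<^sup>+\<eta>. f \<eta> \<partial>env_seq) = (\<integral>\<^sup>+x. f (case x of (a, \<eta>) \<Rightarrow> case_nat a \<eta>) \<partial>(\<nu> \<Otimes>\<^sub>M env_seq))"
    by (subst seq.PiM_iter[symmetric]) (subst nn_integral_distr[OF measurable_case_nat_env], simp_all)
  also have "\<dots> = (\<integral>\<^sup>+a. \<integral>\<^sup>+\<eta>. f (case_nat a \<eta>) \<partial>env_seq \<partial>\<nu>)"
    by (subst seq.nn_integral_fst[symmetric]) (rule measurable_compose[OF measurable_case_nat_env assms], simp)
  finally show ?thesis .
qed

lemma nn_integral_env_seq_prod:
  assumes [measurable]: "\<And>j. f j \<in> borel_measurable \<nu>"
  shows "(\<integral>\<^sup>+\<eta>. (\<Prod>j<n. f j (\<eta> j)) \<partial>env_seq) = (\<Prod>j<n. \<integral>\<^sup>+a. f j a \<partial>\<nu>)"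
  using assms
proof (induction n arbitrary: f)
  case 0
  show ?case by (simp add: seq.P.emeasure_space_1)
next
  case (Suc n)
  have [measurable]: "(\<lambda>\<eta>. f i (\<eta> j)) \<in> borel_measurable env_seq" for i j
    by (rule measurable_compose[OF measurable_env_seq_component Suc.prems])
  note [measurable] = Suc.prems
  have "(\<integral>\<^sup>+\<eta>. (\<Prod>j<Suc n. f j (\<eta> j)) \<partial>env_seq)
      = (\<integral>\<^sup>+a. \<integral>\<^sup>+\<eta>. f 0 a * (\<Prod>j<n. f (Suc j) (\<eta> j)) \<partial>env_seq \<partial>\<nu>)"
    by (subst nn_integral_env_seq) (measurable, simp add: prod.lessThan_Suc_shift del: prod.lessThan_Suc)
  also have "\<dots> = (\<integral>\<^sup>+a. f 0 a \<partial>\<nu>) * (\<Prod>j<n. \<integral>\<^sup>+a. f (Suc j) a \<partial>\<nu>)"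
    by (simp add: nn_integral_cmult nn_integral_multc Suc.IH[OF Suc.prems])
  finally show ?case by (simp add: prod.lessThan_Suc_shift del: prod.lessThan_Suc)
qed

text \<open>
  The maximum of the partial sums \<open>X (\<eta> 0) + \<dots> + X (\<eta> (k - 1))\<close>, \<open>k \<le> n\<close>, with the empty sum
  included, in the form of Lindley's recursion: the first step is split off, so that the remaining maximum
  is independent of it.
\<close>

primrec walk_max :: "(real \<Rightarrow> real) \<Rightarrow> nat \<Rightarrow> (nat \<Rightarrow> real) \<Rightarrow> real" where
  "walk_max X 0 \<eta> = 0"
| "walk_max X (Suc n) \<eta> = max 0 (X (\<eta> 0) + walk_max X n (\<lambda>k. \<eta> (Suc k)))"

lemma walk_max_nonneg: "0 \<le> walk_max X n \<eta>"
  by (cases n) auto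

lemma walk_max_mono_Suc: "walk_max X n \<eta> \<le> walk_max X (Suc n) \<eta>"
proof (induction n arbitrary: \<eta>)
  case (Suc n)
  from Suc[of "\<lambda>k. \<eta> (Suc k)"] show ?case by simp
qed simp

lemma walk_le_walk_max: "(\<Sum>j<n. X (\<eta> j)) \<le> walk_max X n \<eta>"
proof (induction n arbitrary: \<eta>)
  case (Suc n)
  from Suc[of "\<lambda>k. \<eta> (Suc k)"] show ?case by (simp add: sum.lessThan_Suc_shift del: sum.lessThan_Suc)
qed simp

text \<open>
  Let \<open>M\<^sub>n\<close> be \<open>walk_max X n\<close> and \<open>A\<close> the event that \<open>M\<^sub>n\<close> is unbounded. Adding a first step \<open>a\<close> to the
  sequence changes \<open>M\<^sub>n\<close> to \<open>max 0 (X a + M\<^sub>n)\<close> at index \<open>n + 1\<close> and does not change whether \<open>A\<close> occurs.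
  As \<open>M\<^sub>n\<close> increases with \<open>n\<close>, the increment \<open>max 0 (X a + M\<^sub>n) - M\<^sub>n = max (- M\<^sub>n) (X a)\<close> has
  nonnegative expectation on \<open>A\<close>. There \<open>M\<^sub>n\<close> tends to infinity, so the increment tends to \<open>X a\<close>,
  dominated by its modulus. Thus \<open>E X * P(A) \<ge> 0\<close>, and negative drift leaves only \<open>P(A) = 0\<close>. The
  invariance of \<open>A\<close> takes the place of a zero-one law.
\<close>

lemma AE_walk_bounded_above:
  fixes X :: "real \<Rightarrow> real"
  assumes X: "integrable \<nu> X" and drift: "(\<integral>a. X a \<partial>\<nu>) < 0"
  shows "AE \<eta> in env_seq. \<exists>C. \<forall>n. (\<Sum>j<n. X (\<eta> j)) \<le> C"
proof -
  interpret P: pair_sigma_finite \<nu> env_seq ..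
  let ?P2 = "\<nu> \<Otimes>\<^sub>M env_seq"
  have X_meas [measurable]: "X \<in> borel_measurable \<nu>" by (rule borel_measurable_integrable[OF X])
  have [measurable]: "walk_max X n \<in> borel_measurable env_seq" for n
  proof (induction n)
    case (Suc n)
    have "(\<lambda>\<eta>. X (\<eta> 0)) \<in> borel_measurable env_seq"
      by (rule measurable_compose[OF measurable_env_seq_component X_meas])
    moreover have "(\<lambda>\<eta>. walk_max X n (\<lambda>k. \<eta> (Suc k))) \<in> borel_measurable env_seq"
      by (rule measurable_compose[OF measurable_env_seq_shift Suc])
    ultimately show ?case by (simp add: borel_measurable_max)
  qed simp
  have int_max: "integrable env_seq (walk_max X n)" for n
  proof (induction n)
    case (Suc n)
    have "integrable env_seq (\<lambda>\<eta>. X (\<eta> 0))"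
      using X seq.PiM_component[of 0] integrable_distr[of "\<lambda>\<eta>. \<eta> 0" env_seq \<nu> X] by simp
    moreover have "integrable env_seq (\<lambda>\<eta>. walk_max X n (\<lambda>k. \<eta> (Suc k)))"
      using Suc integrable_distr[OF measurable_env_seq_shift, of "walk_max X n"] by (simp add: distr_env_seq_shift)
    ultimately show ?case by simp
  qed simp
  define A where "A = {\<eta>. \<not> (\<exists>C. \<forall>n. walk_max X n \<eta> \<le> C)}"
  have A_nat: "\<eta> \<in> A \<longleftrightarrow> (\<forall>C::nat. \<exists>n. real C < walk_max X n \<eta>)" for \<eta>
  proof -
    have "\<exists>C::nat. \<forall>n. walk_max X n \<eta> \<le> real C" if "\<And>n. walk_max X n \<eta> \<le> c" for c
    proof -
      obtain C :: nat where "c \<le> real C" using real_arch_simple by blast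
      with that show ?thesis by (meson order_trans)
    qed
    then show ?thesis unfolding A_def mem_Collect_eq not_le[symmetric] by blast
  qed
  have [measurable]: "Measurable.pred env_seq (\<lambda>\<eta>. \<eta> \<in> A)"
    unfolding A_nat by measurable
  have inv: "case_nat a \<eta> \<in> A \<longleftrightarrow> \<eta> \<in> A" for a \<eta>
  proof -
    have "\<exists>C. \<forall>n. walk_max X n \<eta> \<le> C" if "\<And>n. walk_max X n (case_nat a \<eta>) \<le> C" for C
    proof (intro exI allI)
      fix n
      show "walk_max X n \<eta> \<le> C - X a" using that[of "Suc n"] by simp
    qed
    moreover have "\<exists>C. \<forall>n. walk_max X n (case_nat a \<eta>) \<le> C" if "\<And>n. walk_max X n \<eta> \<le> C" for C
    proof (intro exI allI)
      fix n
      show "walk_max X n (case_nat a \<eta>) \<le> max 0 (X a + C)"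
        using walk_max_mono_Suc[of X n "case_nat a \<eta>"] that[of n] by simp
    qed
    ultimately show ?thesis unfolding A_def by blast
  qed
  let ?I = "\<lambda>\<eta>. indicator A \<eta> :: real"
  let ?f = "\<lambda>n x. max (- walk_max X n (snd x)) (X (fst x)) * ?I (snd x)"
  have iter: "distr ?P2 env_seq (\<lambda>x. case_nat (fst x) (snd x)) = env_seq"
    using seq.PiM_iter by (simp add: case_prod_beta')
  have snd_distr: "distr ?P2 env_seq snd = env_seq"
  proof (rule measure_eqI)
    fix A assume "A \<in> sets (distr ?P2 env_seq snd)"
    then have A: "A \<in> sets env_seq" by simp
    then have "snd -` A \<inter> space ?P2 = space \<nu> \<times> A"
      using sets.sets_into_space by (auto simp: space_pair_measure)
    with A show "emeasure (distr ?P2 env_seq snd) A = emeasure env_seq A"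
      by (simp add: emeasure_distr seq.P.emeasure_pair_measure_Times emeasure_space_1)
  qed simp
  have int_maxI: "integrable env_seq (\<lambda>\<eta>. walk_max X n \<eta> * ?I \<eta>)" for n
    by (rule Bochner_Integration.integrable_bound[OF int_max[of n]]) (auto simp: indicator_def)
  have nonneg: "0 \<le> (\<integral>x. ?f n x \<partial>?P2)" for n
  proof -
    define g where "g m \<eta> = walk_max X m \<eta> * ?I \<eta>" for m \<eta>
    have g_meas [measurable]: "g m \<in> borel_measurable env_seq" for m
      unfolding g_def by measurable
    have int_g: "integrable env_seq (g m)" for m
      using int_maxI[of m] by (simp add: g_def[abs_def])
    have i1: "integrable ?P2 (\<lambda>x. g (Suc n) (case_nat (fst x) (snd x)))"
      using int_g[of "Suc n"] by (subst integrable_distr_eq[symmetric, where N=env_seq]) (simp_all add: iter)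
    have i2: "integrable ?P2 (\<lambda>x. g n (snd x))"
      using int_g[of n] by (subst integrable_distr_eq[symmetric, where N=env_seq]) (simp_all add: snd_distr)
    have "(\<integral>x. g n (snd x) \<partial>?P2) = (\<integral>\<eta>. g n \<eta> \<partial>env_seq)"
      by (subst (2) snd_distr[symmetric], subst integral_distr) simp_all
    also have "\<dots> \<le> (\<integral>\<eta>. g (Suc n) \<eta> \<partial>env_seq)"
      by (rule integral_mono[OF int_g int_g])
         (simp only: g_def, intro mult_right_mono walk_max_mono_Suc, simp)
    also have "\<dots> = (\<integral>x. g (Suc n) (case_nat (fst x) (snd x)) \<partial>?P2)"
      by (subst iter[symmetric], subst integral_distr) simp_all
    finally have "0 \<le> (\<integral>x. g (Suc n) (case_nat (fst x) (snd x)) - g n (snd x) \<partial>?P2)"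
      using i1 i2 by simp
    also have "\<dots> = (\<integral>x. ?f n x \<partial>?P2)"
    proof (rule Bochner_Integration.integral_cong[OF refl])
      fix x
      have "?I (case_nat (fst x) (snd x)) = ?I (snd x)" by (simp add: indicator_def inv)
      then show "g (Suc n) (case_nat (fst x) (snd x)) - g n (snd x) = ?f n x"
        by (simp add: g_def max_def algebra_simps)
    qed
    finally show ?thesis .
  qed
  have iX: "integrable ?P2 (\<lambda>x. X (fst x))"
    using X integrable_distr[OF measurable_fst, of \<nu> env_seq X] by (simp add: seq.P.distr_pair_fst)
  have "(\<lambda>n. \<integral>x. ?f n x \<partial>?P2) \<longlonglongrightarrow> (\<integral>x. X (fst x) * ?I (snd x) \<partial>?P2)"
  proof (rule integral_dominated_convergence[where w="\<lambda>x. \<bar>X (fst x)\<bar>"])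
    show "integrable ?P2 (\<lambda>x. \<bar>X (fst x)\<bar>)" using iX by simp
    show "AE x in ?P2. (\<lambda>n. ?f n x) \<longlonglongrightarrow> X (fst x) * ?I (snd x)"
    proof (rule AE_I2)
      fix x
      show "(\<lambda>n. ?f n x) \<longlonglongrightarrow> X (fst x) * ?I (snd x)"
      proof (cases "snd x \<in> A")
        case True
        then obtain m where m: "- X (fst x) < walk_max X m (snd x)"
          unfolding A_def by (auto simp: not_le)
        have "eventually (\<lambda>n. ?f n x = X (fst x) * ?I (snd x)) sequentially"
          using eventually_ge_at_top[of m]
        proof eventually_elim
          case (elim n)
          have "walk_max X m (snd x) \<le> walk_max X n (snd x)"
            using elim by (rule lift_Suc_mono_le[rotated]) (rule walk_max_mono_Suc)
          with m show ?case by (simp add: max_def)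
        qed
        then show ?thesis by (rule tendsto_eventually)
      qed simp
    qed
    show "AE x in ?P2. norm (?f n x) \<le> \<bar>X (fst x)\<bar>" for n
      using walk_max_nonneg[of X n] by (auto intro!: AE_I2 simp: indicator_def max_def)
  qed measurable
  then have "0 \<le> (\<integral>x. X (fst x) * ?I (snd x) \<partial>?P2)"
    by (rule LIMSEQ_le_const) (use nonneg in auto)
  also have "\<dots> = (\<integral>a. X a \<partial>\<nu>) * (\<integral>\<eta>. ?I \<eta> \<partial>env_seq)"
    using P.integral_fst'[of "\<lambda>x. X (fst x) * ?I (snd x)"]
      Bochner_Integration.integrable_bound[OF iX, of "\<lambda>x. X (fst x) * ?I (snd x)"]
    by (simp add: indicator_def abs_mult)
  also have "(\<integral>\<eta>. ?I \<eta> \<partial>env_seq) = measure env_seq (A \<inter> space env_seq)"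
    by simp
  finally have "measure env_seq (A \<inter> space env_seq) = 0"
    using drift by (simp add: zero_le_mult_iff measure_le_0_iff)
  then have "AE \<eta> in env_seq. \<eta> \<notin> A"
    by (subst AE_iff_measurable[of "A \<inter> space env_seq"]) (auto simp: seq.P.emeasure_eq_measure)
  then show ?thesis
  proof eventually_elim
    case (elim \<eta>)
    then obtain C where "walk_max X n \<eta> \<le> C" for n unfolding A_def by auto
    with walk_le_walk_max[of X \<eta>] show ?case by (meson order_trans)
  qed
qed

end

section \<open>The random series and its reciprocal\<close>

definition odds :: "real \<Rightarrow> real" where
  "odds a = (1 - a) / a"

definition series_partial :: "nat \<Rightarrow> (nat \<Rightarrow> real) \<Rightarrow> real" where
  "series_partial n \<eta> = (\<Sum>m\<le>n. \<Prod>j<m. odds (\<eta> j))"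

definition series_limit :: "(nat \<Rightarrow> real) \<Rightarrow> ennreal" where
  "series_limit \<eta> = (\<Sum>n. ennreal (\<Prod>j<n. odds (\<eta> j)))"

lemma series_partial_case_nat:
  "series_partial (Suc n) (case_nat a \<eta>) = 1 + odds a * series_partial n \<eta>"
  unfolding series_partial_def
  by (subst sum.atMost_Suc_shift) (simp add: prod.lessThan_Suc_shift sum_distrib_left del: prod.lessThan_Suc)

lemma series_limit_case_nat:
  assumes "0 < a" "a < 1"
  shows "series_limit (case_nat a \<eta>) = 1 + ennreal (odds a) * series_limit \<eta>"
proof -
  have "series_limit (case_nat a \<eta>) = (\<Sum>n. ennreal (\<Prod>j<Suc n. odds (case_nat a \<eta> j))) + 1"
    unfolding series_limit_def
    using suminf_offset[of "\<lambda>n. ennreal (\<Prod>j<n. odds (case_nat a \<eta> j))" 1] by (simp del: prod.lessThan_Suc add: add.commute)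
  also have "(\<Sum>n. ennreal (\<Prod>j<Suc n. odds (case_nat a \<eta> j))) = (\<Sum>n. ennreal (odds a) * ennreal (\<Prod>j<n. odds (\<eta> j)))"
  proof -
    have "0 \<le> odds a" using assms by (simp add: odds_def)
    then show ?thesis by (simp add: prod.lessThan_Suc_shift ennreal_mult' del: prod.lessThan_Suc)
  qed
  finally show ?thesis by (simp add: series_limit_def add.commute)
qed

definition series_recip :: "(nat \<Rightarrow> real) \<Rightarrow> real" where
  "series_recip \<eta> = enn2real (inverse (series_limit \<eta>))"

lemma S_env_eq_series_recip: "S_env \<omega> = series_recip (\<lambda>n. \<omega> (int (Suc n)))"
proof -
  have "(\<Prod>j = 1..n. rho \<omega> (int j)) = (\<Prod>j<n. odds (\<omega> (int (Suc j))))" for n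
    by (simp add: prod.atLeast1_atMost_eq rho_def odds_def)
  then show ?thesis by (simp add: S_env_def series_recip_def series_limit_def)
qed

lemma series_limit_ge_1: "1 \<le> series_limit \<eta>"
  unfolding series_limit_def
  using sum_le_suminf[of "\<lambda>n. ennreal (\<Prod>j<n. odds (\<eta> j))" "{0}"] by simp

lemma series_limit_finiteE:
  assumes "series_limit \<eta> < \<infinity>"
  obtains v where "1 \<le> v" "series_limit \<eta> = ennreal v" "series_recip \<eta> = inverse v"
proof (cases "series_limit \<eta>")
  case (real v)
  then have "1 \<le> v" using series_limit_ge_1[of \<eta>] by (simp flip: ennreal_1)
  with real that show ?thesis by (simp add: series_recip_def inverse_ennreal)
qed (use assms in simp)

lemma series_recip_le_1: "0 \<le> series_recip \<eta>" "series_recip \<eta> \<le> 1"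
proof -
  show "0 \<le> series_recip \<eta>" by (simp add: series_recip_def)
  show "series_recip \<eta> \<le> 1"
  proof (cases "series_limit \<eta> < \<infinity>")
    case True
    then show ?thesis by (rule series_limit_finiteE) (simp add: inverse_le_1_iff)
  qed (simp add: series_recip_def less_top[symmetric])
qed

lemma series_recip_pos:
  assumes "series_limit \<eta> < \<infinity>"
  shows "0 < series_recip \<eta>"
  using assms by (rule series_limit_finiteE) simp

lemma series_recip_less_1:
  assumes "0 < \<eta> 0" "\<eta> 0 < 1"
  shows "series_recip \<eta> < 1"
proof -
  have "1 < 1 + ennreal (odds (\<eta> 0))" using assms by (simp add: odds_def)
  also have "\<dots> \<le> series_limit \<eta>"
    unfolding series_limit_def
    using sum_le_suminf[of "\<lambda>n. ennreal (\<Prod>j<n. odds (\<eta> j))" "{0, 1}"] by simp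
  finally have *: "1 < series_limit \<eta>" .
  show ?thesis
  proof (cases "series_limit \<eta> < \<infinity>")
    case True
    then obtain v where "1 \<le> v" "series_limit \<eta> = ennreal v" "series_recip \<eta> = inverse v"
      by (rule series_limit_finiteE)
    with * show ?thesis by (simp add: inverse_less_1_iff ennreal_less_iff flip: ennreal_1)
  qed (simp add: series_recip_def less_top[symmetric])
qed

text \<open>
  The recursion \<open>1 / S = 1 + \<rho>\<^sub>1 / S'\<close>. Finiteness matters here: for a divergent series \<open>S = 0\<close> and the
  right-hand side would be \<open>1\<close>.
\<close>

lemma series_recip_case_nat:
  assumes "0 < a" "a < 1" and fin: "series_limit \<eta> < \<infinity>"
  shows "series_recip (case_nat a \<eta>) = inverse (1 + (1 - a) / a * inverse (series_recip \<eta>))"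
proof -
  obtain v where v: "1 \<le> v" "series_limit \<eta> = ennreal v" "series_recip \<eta> = inverse v"
    using fin by (rule series_limit_finiteE)
  have odds: "0 < odds a" using assms by (simp add: odds_def)
  have "series_limit (case_nat a \<eta>) = ennreal (1 + odds a * v)"
    using v odds assms by (simp add: series_limit_case_nat ennreal_mult)
  moreover have "0 < 1 + odds a * v" using v odds by (simp add: add_pos_pos)
  ultimately have "series_recip (case_nat a \<eta>) = inverse (1 + odds a * v)"
    by (simp add: series_recip_def inverse_ennreal)
  then show ?thesis by (simp add: v odds_def)
qed

context env_marginal
begin

lemma measurable_odds [measurable]: "odds \<in> borel_measurable \<nu>"
  unfolding odds_def[abs_def] by measurable

lemma measurable_odds_component [measurable]: "(\<lambda>\<eta>. odds (\<eta> n)) \<in> borel_measurable env_seq"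
  by (rule measurable_compose[OF measurable_env_seq_component measurable_odds])

lemma measurable_series_partial [measurable]: "series_partial n \<in> borel_measurable env_seq"
  unfolding series_partial_def[abs_def] by measurable

lemma measurable_series_limit [measurable]: "series_limit \<in> borel_measurable env_seq"
  unfolding series_limit_def[abs_def] by measurable

lemma measurable_series_recip [measurable]: "series_recip \<in> borel_measurable env_seq"
  unfolding series_recip_def[abs_def] by measurable

lemma series_partial_pos:
  assumes "\<eta> \<in> space env_seq"
  shows "1 \<le> series_partial n \<eta>"
proof -
  have "(\<Sum>m\<in>{0}. \<Prod>j<m. odds (\<eta> j)) \<le> series_partial n \<eta>"
    unfolding series_partial_def using assms
    by (intro sum_mono2) (auto intro!: prod_nonneg simp: space_env_seq odds_def less_imp_le)
  then show ?thesis by simp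
qed

lemma ennreal_series_partial:
  assumes "\<eta> \<in> space env_seq"
  shows "ennreal (series_partial n \<eta>) = (\<Sum>m<Suc n. ennreal (\<Prod>j<m. odds (\<eta> j)))"
  unfolding series_partial_def lessThan_Suc_atMost using assms
  by (intro sum_ennreal[symmetric]) (auto intro!: prod_nonneg simp: space_env_seq odds_def less_imp_le)

lemma inverse_series_partial_tendsto:
  assumes \<eta>: "\<eta> \<in> space env_seq" and fin: "series_limit \<eta> < \<infinity>"
  shows "(\<lambda>n. inverse (series_partial n \<eta>)) \<longlonglongrightarrow> series_recip \<eta>"
proof -
  obtain v where v: "1 \<le> v" "series_limit \<eta> = ennreal v" "series_recip \<eta> = inverse v"
    using fin by (rule series_limit_finiteE)
  have "(\<lambda>n. ennreal (series_partial n \<eta>)) \<longlonglongrightarrow> ennreal v"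
    unfolding ennreal_series_partial[OF \<eta>] v(2)[symmetric] series_limit_def
    by (intro LIMSEQ_Suc summable_LIMSEQ summableI)
  then have "(\<lambda>n. series_partial n \<eta>) \<longlonglongrightarrow> v"
    using v series_partial_pos[OF \<eta>] by (subst (asm) tendsto_ennreal_iff) (auto intro!: always_eventually order_trans[OF zero_le_one])
  then show ?thesis
    unfolding v(3) using v by (intro tendsto_inverse) auto
qed

lemma series_recip_le_inverse_series_partial:
  assumes \<eta>: "\<eta> \<in> space env_seq"
  shows "series_recip \<eta> \<le> inverse (series_partial n \<eta>)"
proof (cases "series_limit \<eta> < \<infinity>")
  case True
  then obtain v where v: "1 \<le> v" "series_limit \<eta> = ennreal v" "series_recip \<eta> = inverse v"
    by (rule series_limit_finiteE)
  have "ennreal (series_partial n \<eta>) \<le> ennreal v"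
    unfolding ennreal_series_partial[OF \<eta>] v(2)[symmetric] series_limit_def by (intro sum_le_suminf) auto
  then have "series_partial n \<eta> \<le> v" using v by (simp add: ennreal_le_iff)
  then show ?thesis
    unfolding v(3) using series_partial_pos[OF \<eta>, of n] by (intro le_imp_inverse_le) auto
qed (use series_partial_pos[OF \<eta>, of n] in \<open>simp add: series_recip_def less_top[symmetric]\<close>)

lemma nn_integral_series_limit:
  "(\<integral>\<^sup>+\<eta>. series_limit \<eta> \<partial>env_seq) = (\<Sum>n. (\<integral>\<^sup>+a. ennreal (odds a) \<partial>\<nu>) ^ n)"
proof -
  have "(\<integral>\<^sup>+\<eta>. ennreal (\<Prod>j<n. odds (\<eta> j)) \<partial>env_seq) = (\<integral>\<^sup>+\<eta>. (\<Prod>j<n. ennreal (odds (\<eta> j))) \<partial>env_seq)" for n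
    by (intro nn_integral_cong prod_ennreal[symmetric]) (auto simp: space_env_seq odds_def less_imp_le)
  then have "(\<integral>\<^sup>+\<eta>. ennreal (\<Prod>j<n. odds (\<eta> j)) \<partial>env_seq) = (\<integral>\<^sup>+a. ennreal (odds a) \<partial>\<nu>) ^ n" for n
    by (simp, subst nn_integral_env_seq_prod) simp_all
  then show ?thesis unfolding series_limit_def by (subst nn_integral_suminf) auto
qed

text \<open>
  The walk with half of its drift removed is bounded above, so the terms of the series are dominated by a
  geometric sequence.
\<close>

lemma AE_series_limit_finite:
  assumes int: "integrable \<nu> (\<lambda>a. ln (odds a))" and drift: "(\<integral>a. ln (odds a) \<partial>\<nu>) < 0"
  shows "AE \<eta> in env_seq. series_limit \<eta> < \<infinity>"
proof -
  \<comment> \<open>Half of the drift: the walk with steps \<open>ln (odds a) + \<epsilon>\<close> still drifts to minus infinity.\<close>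
  define \<epsilon> where "\<epsilon> = - (\<integral>a. ln (odds a) \<partial>\<nu>) / 2"
  have \<epsilon>: "0 < \<epsilon>" using drift by (simp add: \<epsilon>_def)
  have "(\<integral>a. ln (odds a) + \<epsilon> \<partial>\<nu>) < 0"
    using int drift by (simp add: prob_space \<epsilon>_def)
  then have "AE \<eta> in env_seq. \<exists>C. \<forall>n. (\<Sum>j<n. ln (odds (\<eta> j)) + \<epsilon>) \<le> C"
    using int by (intro AE_walk_bounded_above) auto
  then show ?thesis
    using AE_space
  proof eventually_elim
    case (elim \<eta>)
    then obtain C where C: "\<And>n. (\<Sum>j<n. ln (odds (\<eta> j)) + \<epsilon>) \<le> C" by auto
    have bound: "(\<Prod>j<n. odds (\<eta> j)) \<le> exp C * exp (- \<epsilon>) ^ n" for n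
    proof -
      have "(\<Prod>j<n. odds (\<eta> j)) = exp (\<Sum>j<n. ln (odds (\<eta> j)))"
        using elim by (simp add: exp_sum space_env_seq odds_def)
      also have "(\<Sum>j<n. ln (odds (\<eta> j))) \<le> C - real n * \<epsilon>"
        using C[of n] by (simp add: sum.distrib)
      also have "exp (C - real n * \<epsilon>) = exp C * exp (- \<epsilon>) ^ n"
        by (simp flip: exp_of_nat_mult exp_add)
      finally show ?thesis by simp
    qed
    have "summable (\<lambda>n. exp C * exp (- \<epsilon>) ^ n)"
      using \<epsilon> by (intro summable_mult summable_geometric) simp
    then have "(\<Sum>n. ennreal (exp C * exp (- \<epsilon>) ^ n)) < \<infinity>"
      by (subst suminf_ennreal2) auto
    moreover have "series_limit \<eta> \<le> (\<Sum>n. ennreal (exp C * exp (- \<epsilon>) ^ n))"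
      unfolding series_limit_def by (intro suminf_le ennreal_leI bound) auto
    ultimately show ?case by (rule le_less_trans[rotated])
  qed
qed

end

section \<open>Path probabilities of the branching process\<close>

context
  fixes \<omega> :: "int \<Rightarrow> real"
begin

abbreviation offspring_index :: "(nat \<times> nat) set" where
  "offspring_index \<equiv> {1..} \<times> UNIV"

abbreviation offspring_measure :: "nat \<times> nat \<Rightarrow> nat measure" where
  "offspring_measure \<equiv> \<lambda>(k, i). measure_pmf (geometric_pmf (\<omega> (int k)))"

interpretation Q: prob_space "quenched_law \<omega>"
  unfolding quenched_law_def
  by (rule prob_space_PiM) (auto split: prod.split simp: measure_pmf.prob_space_axioms)

lemma measurable_offspring:
  assumes "x \<in> offspring_index"
  shows "(\<lambda>\<xi>. \<xi> x) \<in> quenched_law \<omega> \<rightarrow>\<^sub>M count_space UNIV"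
proof -
  have "(\<lambda>\<xi>. \<xi> x) \<in> quenched_law \<omega> \<rightarrow>\<^sub>M offspring_measure x"
    unfolding quenched_law_def using assms by (rule measurable_component_singleton)
  then show ?thesis by (simp add: case_prod_beta')
qed

lemma distr_offspring:
  assumes "1 \<le> k"
  shows "distr (quenched_law \<omega>) (count_space UNIV) (\<lambda>\<xi>. \<xi> (k, i)) = measure_pmf (geometric_pmf (\<omega> (int k)))"
proof -
  have "distr (quenched_law \<omega>) (count_space UNIV) (\<lambda>\<xi>. \<xi> (k, i))
      = distr (quenched_law \<omega>) (offspring_measure (k, i)) (\<lambda>\<xi>. \<xi> (k, i))"
    by (rule distr_cong) auto
  also have "\<dots> = offspring_measure (k, i)"
    unfolding quenched_law_def using assms
    by (intro distr_PiM_component) (auto split: prod.split simp: measure_pmf.prob_space_axioms)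
  finally show ?thesis by simp
qed

lemma indep_vars_offspring:
  "Q.indep_vars (\<lambda>_. count_space UNIV) (\<lambda>x \<xi>. \<xi> x) offspring_index"
proof (subst Q.indep_vars_iff_distr_eq_PiM')
  show "offspring_index \<noteq> {}" by auto
  show "(\<lambda>\<xi>. \<xi> x) \<in> quenched_law \<omega> \<rightarrow>\<^sub>M count_space UNIV" if "x \<in> offspring_index" for x
    using that by (rule measurable_offspring)
  have "distr (quenched_law \<omega>) (\<Pi>\<^sub>M i\<in>offspring_index. count_space UNIV) (\<lambda>\<xi>. \<lambda>i\<in>offspring_index. \<xi> i)
      = distr (quenched_law \<omega>) (quenched_law \<omega>) (\<lambda>\<xi>. \<xi>)"
  proof (rule distr_cong)
    show "sets (\<Pi>\<^sub>M i\<in>offspring_index. count_space UNIV) = sets (quenched_law \<omega>)"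
      unfolding quenched_law_def by (rule sets_PiM_cong) (auto split: prod.split)
    show "(\<lambda>i\<in>offspring_index. \<xi> i) = \<xi>" if "\<xi> \<in> space (quenched_law \<omega>)" for \<xi>
      using that unfolding quenched_law_def space_PiM by (rule PiE_restrict)
  qed simp
  also have "\<dots> = quenched_law \<omega>" by (rule distr_id)
  also have "\<dots> = PiM offspring_index offspring_measure" by (rule quenched_law_def)
  also have "\<dots> = (\<Pi>\<^sub>M i\<in>offspring_index. distr (quenched_law \<omega>) (count_space UNIV) (\<lambda>\<xi>. \<xi> i))"
    by (rule PiM_cong) (auto simp: distr_offspring)
  finally show "distr (quenched_law \<omega>) (\<Pi>\<^sub>M i\<in>offspring_index. count_space UNIV) (\<lambda>\<xi>. \<lambda>i\<in>offspring_index. \<xi> i)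
      = (\<Pi>\<^sub>M i\<in>offspring_index. distr (quenched_law \<omega>) (count_space UNIV) (\<lambda>\<xi>. \<xi> i))" .
qed

lemma measurable_offspring_sum:
  "1 \<le> k \<Longrightarrow> (\<lambda>\<xi>. \<Sum>i<n. \<xi> (k, i)) \<in> quenched_law \<omega> \<rightarrow>\<^sub>M count_space UNIV"
  by (intro measurable_sum_nat measurable_offspring) auto

text \<open>
  A generation with \<open>n\<close> parents has a negative binomial size. The induction splits off the last offspring
  variable, which is independent of the sum of the others.
\<close>

lemma nn_integral_offspring_sum:
  fixes f :: "nat \<Rightarrow> ennreal"
  assumes k: "1 \<le> k"
  shows "(\<integral>\<^sup>+\<xi>. f (\<Sum>i<n. \<xi> (k, i)) \<partial>quenched_law \<omega>) = (\<integral>\<^sup>+m. f m \<partial>neg_binomial_pmf n (\<omega> (int k)))"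
proof (induction n arbitrary: f)
  case 0
  show ?case by (simp add: Q.emeasure_space_1 nn_integral_return_pmf)
next
  case (Suc n)
  let ?C = "count_space UNIV :: nat measure"
  let ?X = "\<lambda>\<xi> :: nat \<times> nat \<Rightarrow> nat. \<xi> (k, n)" and ?Y = "\<lambda>\<xi> :: nat \<times> nat \<Rightarrow> nat. \<Sum>i<n. \<xi> (k, i)"
  have X [measurable]: "?X \<in> quenched_law \<omega> \<rightarrow>\<^sub>M ?C" and Y [measurable]: "?Y \<in> quenched_law \<omega> \<rightarrow>\<^sub>M ?C"
    using k by (auto intro: measurable_offspring measurable_offspring_sum)
  have "Q.indep_var ?C ((\<lambda>g. g (k, n)) \<circ> (\<lambda>\<xi>. restrict (\<lambda>i. \<xi> i) {(k, n)}))
      ?C ((\<lambda>g. \<Sum>i<n. g (k, i)) \<circ> (\<lambda>\<xi>. restrict (\<lambda>i. \<xi> i) ({k} \<times> {..<n})))"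
    using k by (intro Q.indep_var_compose[OF Q.indep_var_restrict[OF indep_vars_offspring]]
        measurable_sum_nat measurable_component_singleton) auto
  also have "((\<lambda>g. g (k, n)) \<circ> (\<lambda>\<xi>. restrict (\<lambda>i. \<xi> i) {(k, n)})) = ?X"
    by auto
  also have "((\<lambda>g. \<Sum>i<n. g (k, i)) \<circ> (\<lambda>\<xi>. restrict (\<lambda>i. \<xi> i) ({k} \<times> {..<n}))) = ?Y"
    by (auto simp: fun_eq_iff)
  finally have "distr (quenched_law \<omega>) ?C ?X \<Otimes>\<^sub>M distr (quenched_law \<omega>) ?C ?Y
      = distr (quenched_law \<omega>) (?C \<Otimes>\<^sub>M ?C) (\<lambda>\<xi>. (?X \<xi>, ?Y \<xi>))"
    by (simp add: Q.indep_var_distribution_eq)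
  note joint = this[symmetric]
  have [measurable]: "(\<lambda>x. f (snd x + fst x)) \<in> borel_measurable (?C \<Otimes>\<^sub>M ?C)"
    by (simp add: pair_measure_countable)
  interpret Y: prob_space "distr (quenched_law \<omega>) ?C ?Y" by (rule Q.prob_space_distr[OF Y])
  have "(\<integral>\<^sup>+\<xi>. f (\<Sum>i<Suc n. \<xi> (k, i)) \<partial>quenched_law \<omega>)
      = (\<integral>\<^sup>+x. f (snd x + fst x) \<partial>distr (quenched_law \<omega>) (?C \<Otimes>\<^sub>M ?C) (\<lambda>\<xi>. (?X \<xi>, ?Y \<xi>)))"
    by (subst nn_integral_distr) simp_all
  also have "\<dots> = (\<integral>\<^sup>+a. \<integral>\<^sup>+b. f (b + a) \<partial>distr (quenched_law \<omega>) ?C ?Y \<partial>distr (quenched_law \<omega>) ?C ?X)"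
    unfolding joint
    by (subst Y.nn_integral_fst[symmetric]) (auto simp: pair_measure_countable sets_pair_measure_cong[OF sets_distr sets_distr] cong: measurable_cong_sets)
  also have "\<dots> = (\<integral>\<^sup>+a. \<integral>\<^sup>+b. f (b + a) \<partial>neg_binomial_pmf n (\<omega> (int k)) \<partial>geometric_pmf (\<omega> (int k)))"
    unfolding distr_offspring[OF k]
    by (intro nn_integral_cong) (simp add: nn_integral_distr Suc[of "\<lambda>m. f (m + a)" for a])
  also have "\<dots> = (\<integral>\<^sup>+m. f m \<partial>neg_binomial_pmf (Suc n) (\<omega> (int k)))"
    by (simp add: neg_binomial_pmf_Suc nn_integral_pair_pmf' case_prod_beta' add.commute)
  finally show ?case .
qed

lemma prob_offspring_sum:
  assumes k: "1 \<le> k"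
  shows "Q.prob ((\<lambda>\<xi>. \<Sum>i<n. \<xi> (k, i)) -` {m} \<inter> space (quenched_law \<omega>)) = pmf (neg_binomial_pmf n (\<omega> (int k))) m"
proof -
  note [measurable] = measurable_offspring_sum[OF k]
  have "emeasure (quenched_law \<omega>) ((\<lambda>\<xi>. \<Sum>i<n. \<xi> (k, i)) -` {m} \<inter> space (quenched_law \<omega>))
      = (\<integral>\<^sup>+\<xi>. indicator {m} (\<Sum>i<n. \<xi> (k, i)) \<partial>quenched_law \<omega>)"
    by (subst nn_integral_indicator[symmetric, OF measurable_sets[OF measurable_offspring_sum[OF k]]], simp)
       (rule nn_integral_cong, simp split: split_indicator)
  also have "\<dots> = ennreal (pmf (neg_binomial_pmf n (\<omega> (int k))) m)"
    by (simp add: nn_integral_offspring_sum[OF k] emeasure_pmf_single)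
  finally show ?thesis by (simp add: Q.emeasure_eq_measure)
qed

text \<open>
  Along a prescribed path the numbers of parents are constants, so the generation sizes are sums over
  disjoint blocks of offspring variables and hence independent.
\<close>

lemma prob_offspring_sums:
  "Q.prob {\<xi> \<in> space (quenched_law \<omega>). \<forall>j<n. (\<Sum>i<s j. \<xi> (Suc j, i)) = w j}
    = (\<Prod>j<n. pmf (neg_binomial_pmf (s j) (\<omega> (int (Suc j)))) (w j))"
proof (cases "n = 0")
  case False
  let ?C = "count_space UNIV :: nat measure"
  let ?B = "\<lambda>j. {Suc j} \<times> {..<s j}"
  have "Q.indep_vars (\<lambda>_. ?C) (\<lambda>j \<xi>. (\<lambda>g. \<Sum>i<s j. g (Suc j, i)) (restrict (\<lambda>i. \<xi> i) (?B j))) {..<n}"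
    by (intro Q.indep_vars_compose2[OF Q.indep_vars_restrict[OF indep_vars_offspring]]
        measurable_sum_nat measurable_component_singleton)
       (auto simp: disjoint_family_on_def)
  then have ind: "Q.indep_vars (\<lambda>_. ?C) (\<lambda>j \<xi>. \<Sum>i<s j. \<xi> (Suc j, i)) {..<n}"
    by simp
  have "{\<xi> \<in> space (quenched_law \<omega>). \<forall>j<n. (\<Sum>i<s j. \<xi> (Suc j, i)) = w j}
      = (\<Inter>j\<in>{..<n}. (\<lambda>\<xi>. \<Sum>i<s j. \<xi> (Suc j, i)) -` {w j} \<inter> space (quenched_law \<omega>))"
    using False by auto
  also have "Q.prob \<dots> = (\<Prod>j<n. Q.prob ((\<lambda>\<xi>. \<Sum>i<s j. \<xi> (Suc j, i)) -` {w j} \<inter> space (quenched_law \<omega>)))"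
    using False by (intro Q.indep_varsD_finite[OF ind]) auto
  also have "\<dots> = (\<Prod>j<n. pmf (neg_binomial_pmf (s j) (\<omega> (int (Suc j)))) (w j))"
    by (intro prod.cong refl prob_offspring_sum) simp
  finally show ?thesis .
qed (simp add: Q.prob_space)

end

lemma branching_path_iff:
  "(\<forall>j\<le>n. branching z \<xi> j = w j) \<longleftrightarrow> w 0 = z \<and> (\<forall>j<n. (\<Sum>i<Suc (w j). \<xi> (Suc j, i)) = w (Suc j))"
proof (induction n)
  case (Suc n)
  have "(\<forall>j\<le>Suc n. branching z \<xi> j = w j)
      \<longleftrightarrow> (\<forall>j\<le>n. branching z \<xi> j = w j) \<and> branching z \<xi> (Suc n) = w (Suc n)"
    by (auto simp: le_Suc_eq)
  also have "\<dots> \<longleftrightarrow> (\<forall>j\<le>n. branching z \<xi> j = w j) \<and> (\<Sum>i<Suc (w n). \<xi> (Suc n, i)) = w (Suc n)"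
    by (auto simp: lessThan_Suc_atMost atLeast0AtMost)
  also have "\<dots> \<longleftrightarrow> w 0 = z \<and> (\<forall>j<Suc n. (\<Sum>i<Suc (w j). \<xi> (Suc j, i)) = w (Suc j))"
    unfolding Suc by (auto simp: less_Suc_eq)
  finally show ?case .
qed auto

abbreviation offspring_space :: "(nat \<times> nat \<Rightarrow> nat) measure" where
  "offspring_space \<equiv> PiM ({1..} \<times> UNIV) (\<lambda>_. count_space UNIV)"

lemma sets_quenched_law: "sets (quenched_law \<omega>) = sets offspring_space"
  unfolding quenched_law_def by (rule sets_PiM_cong) (auto split: prod.split)

lemma measurable_branching [measurable]: "(\<lambda>\<xi>. branching z \<xi> n) \<in> offspring_space \<rightarrow>\<^sub>M count_space UNIV"
proof (induction n)
  case (Suc n)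
  have "(\<lambda>\<xi>. \<Sum>i = 0..m. \<xi> (Suc n, i)) \<in> offspring_space \<rightarrow>\<^sub>M count_space UNIV" for m
    by (intro measurable_sum_nat measurable_component_singleton) auto
  from measurable_compose_countable[OF this Suc] show ?case by simp
qed simp

context env_marginal
begin

lemma sets_annealed_law: "sets (annealed_law \<nu>) = sets offspring_space"
proof -
  have "space (env_law \<nu>) \<noteq> {}"
    unfolding env_law_def by (intro prob_space.not_empty prob_space_PiM prob_space_marginal)
  then show ?thesis
    unfolding annealed_law_def
    using sets_bind[OF sets_kernel[OF measurable_quenched_law[OF distribution_01]]] by simp
qed

lemma space_annealed_law: "space (annealed_law \<nu>) = space offspring_space"
  using sets_annealed_law by (rule sets_eq_imp_space_eq)

text \<open>
  The Markov property of the annealed process, in its finite-dimensional form. Under the quenched law the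
  probability of a path is a product in which the \<open>j\<close>-th factor depends only on the \<open>(j + 1)\<close>-st
  environment value; integrating over an i.i.d. environment turns each factor into a transition
  probability.
\<close>

lemma emeasure_annealed_path:
  "emeasure (annealed_law \<nu>) {\<xi> \<in> space (annealed_law \<nu>). \<forall>j\<le>n. branching z \<xi> j = w j}
    = (if w 0 = z then \<Prod>j<n. ennreal (pmf (K (w j)) (w (Suc j))) else 0)"
proof (cases "w 0 = z")
  case True
  let ?A = "{\<xi> \<in> space (annealed_law \<nu>). \<forall>j\<le>n. branching z \<xi> j = w j}"
  let ?f = "\<lambda>j a. ennreal (pmf (neg_binomial_pmf (Suc (w j)) a) (w (Suc j)))"
  have "?A \<in> sets offspring_space" unfolding space_annealed_law by measurable
  then have "emeasure (annealed_law \<nu>) ?A = (\<integral>\<^sup>+\<omega>. emeasure (quenched_law \<omega>) ?A \<partial>env_law \<nu>)"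
    by (rule emeasure_annealed_law[OF distribution_01])
  also have "\<dots> = (\<integral>\<^sup>+\<omega>. (\<Prod>j<n. ?f j (\<omega> (int (Suc j)))) \<partial>env_law \<nu>)"
  proof (rule nn_integral_cong)
    fix \<omega>
    interpret Q: prob_space "quenched_law \<omega>"
      unfolding quenched_law_def
      by (rule prob_space_PiM) (auto split: prod.split simp: measure_pmf.prob_space_axioms)
    have "?A = {\<xi> \<in> space (quenched_law \<omega>). \<forall>j<n. (\<Sum>i<Suc (w j). \<xi> (Suc j, i)) = w (Suc j)}"
      unfolding branching_path_iff space_annealed_law sets_eq_imp_space_eq[OF sets_quenched_law] using True by blast
    then show "emeasure (quenched_law \<omega>) ?A = (\<Prod>j<n. ?f j (\<omega> (int (Suc j))))"
      by (simp only: Q.emeasure_eq_measure prob_offspring_sums) (simp add: prod_ennreal)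
  qed
  also have "\<dots> = (\<integral>\<^sup>+\<eta>. (\<Prod>j<n. ?f j (\<eta> j)) \<partial>distr (env_law \<nu>) env_seq (\<lambda>\<omega> n. \<omega> (int (Suc n))))"
  proof (rule nn_integral_distr[symmetric])
    show "(\<lambda>\<omega> n. \<omega> (int (Suc n))) \<in> env_law \<nu> \<rightarrow>\<^sub>M env_seq"
      unfolding env_law_def by (rule measurable_PiM_single') (auto simp: space_PiM PiE_iff)
    have [measurable]: "(\<lambda>\<eta>. ?f j (\<eta> j)) \<in> borel_measurable env_seq" for j
      by (rule measurable_compose[OF measurable_env_seq_component]) measurable
    show "(\<lambda>\<eta>. \<Prod>j<n. ?f j (\<eta> j)) \<in> borel_measurable (distr (env_law \<nu>) env_seq (\<lambda>\<omega> n. \<omega> (int (Suc n))))"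
      unfolding distr_env_law_shift by (intro borel_measurable_prod_ennreal) measurable
  qed
  also have "\<dots> = (\<Prod>j<n. ennreal (pmf (K (w j)) (w (Suc j))))"
    unfolding distr_env_law_shift by (subst nn_integral_env_seq_prod) (simp_all add: ennreal_pmf_K)
  finally show ?thesis using True by simp
next
  case False
  then have "{\<xi> \<in> space (annealed_law \<nu>). \<forall>j\<le>n. branching z \<xi> j = w j} = {}"
    by (auto dest!: spec[of _ 0])
  with False show ?thesis by (simp only: if_False emeasure_empty)
qed

end

section \<open>Discrete Markov chains\<close>

primrec step_law :: "('a \<Rightarrow> 'a pmf) \<Rightarrow> nat \<Rightarrow> 'a \<Rightarrow> 'a pmf" where
  "step_law K 0 z = return_pmf z"
| "step_law K (Suc n) z = bind_pmf (step_law K n z) K"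

text \<open>
  The law of the history of the chain up to time \<open>n\<close>, as a list with the most recent state first.
\<close>

primrec path_pmf :: "('a \<Rightarrow> 'a pmf) \<Rightarrow> nat \<Rightarrow> 'a \<Rightarrow> 'a list pmf" where
  "path_pmf K 0 z = return_pmf [z]"
| "path_pmf K (Suc n) z = bind_pmf (path_pmf K n z) (\<lambda>l. map_pmf (\<lambda>y. y # l) (K (hd l)))"

text \<open>
  The probability that the chain started from \<open>y\<close> does not visit \<open>x\<close> at the times \<open>1, \<dots>, n\<close>. Time 0
  is not counted, so for \<open>y = x\<close> it is the tail of the return time.
\<close>

primrec avoid_prob :: "('a \<Rightarrow> 'a pmf) \<Rightarrow> 'a \<Rightarrow> nat \<Rightarrow> 'a \<Rightarrow> ennreal" where
  "avoid_prob K x 0 y = 1"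
| "avoid_prob K x (Suc n) y = (\<integral>\<^sup>+z. (if z = x then 0 else avoid_prob K x n z) \<partial>K y)"

lemma step_law_Suc_left: "step_law K (Suc n) z = bind_pmf (K z) (step_law K n)"
proof (induction n)
  case 0
  show ?case by (simp add: bind_return_pmf bind_return_pmf')
next
  case (Suc n)
  have "step_law K (Suc (Suc n)) z = bind_pmf (bind_pmf (K z) (step_law K n)) K"
    using Suc by simp
  then show ?case by (simp add: bind_assoc_pmf)
qed

lemma pmf_bind_ge: "pmf p x * pmf (f x) y \<le> pmf (bind_pmf p f) y"
proof -
  have "ennreal (pmf p x * pmf (f x) y) = (\<integral>\<^sup>+z. ennreal (pmf (f x) y) * indicator {x} z \<partial>p)"
    by (simp add: nn_integral_cmult emeasure_pmf_single ennreal_mult mult.commute)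
  also have "\<dots> \<le> (\<integral>\<^sup>+z. ennreal (pmf (f z) y) \<partial>p)"
    by (intro nn_integral_mono) (simp split: split_indicator)
  finally show ?thesis by (simp flip: ennreal_pmf_bind)
qed

lemma path_pmf_nonempty: "l \<in> set_pmf (path_pmf K n z) \<Longrightarrow> l \<noteq> []"
  by (cases n) auto

lemma map_hd_path_pmf: "map_pmf hd (path_pmf K n z) = step_law K n z"
proof (induction n)
  case (Suc n)
  have "map_pmf hd (path_pmf K (Suc n) z) = bind_pmf (map_pmf hd (path_pmf K n z)) K"
    by (simp add: map_bind_pmf bind_map_pmf pmf.map_comp comp_def)
  then show ?case by (simp add: Suc)
qed simp

lemma pmf_path_pmf_Cons: "pmf (path_pmf K (Suc n) z) (y # l) = pmf (path_pmf K n z) l * pmf (K (hd l)) y"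
proof -
  have "pmf (map_pmf (\<lambda>y. y # l') (K (hd l'))) (y # l) = pmf (K (hd l)) y * indicator {l} l'" for l'
  proof (cases "l' = l")
    case True
    have "inj (\<lambda>y. y # l)" by (simp add: inj_on_def)
    from pmf_map_inj'[OF this, of "K (hd l)" y] True show ?thesis by simp
  next
    case False
    then show ?thesis by (auto simp: pmf_eq_0_set_pmf)
  qed
  then show ?thesis
    by (simp add: pmf_bind measure_pmf_single)
qed

text \<open>
  The last entry of a history is the state at time 0, so \<open>butlast\<close> selects the times at which visits to
  \<open>x\<close> count. The extra \<open>m\<close> steps make the statement inductive; the case of interest is \<open>m = 0\<close>.
\<close>

lemma nn_integral_path_avoid:
  "(\<integral>\<^sup>+l. indicator {l. x \<notin> set (butlast l)} l * avoid_prob K x m (hd l) \<partial>path_pmf K n z)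
    = avoid_prob K x (n + m) z"
proof (induction n arbitrary: m)
  case 0
  show ?case by (simp add: nn_integral_return_pmf)
next
  case (Suc n)
  have "(\<integral>\<^sup>+l. indicator {l. x \<notin> set (butlast l)} l * avoid_prob K x m (hd l) \<partial>path_pmf K (Suc n) z)
      = (\<integral>\<^sup>+l. \<integral>\<^sup>+y. indicator {l. x \<notin> set (butlast l)} (y # l) * avoid_prob K x m y \<partial>K (hd l) \<partial>path_pmf K n z)"
    by simp
  also have "\<dots> = (\<integral>\<^sup>+l. indicator {l. x \<notin> set (butlast l)} l * avoid_prob K x (Suc m) (hd l) \<partial>path_pmf K n z)"
  proof (rule nn_integral_cong_AE, rule AE_pmfI)
    fix l assume "l \<in> set_pmf (path_pmf K n z)"
    then have "l \<noteq> []" by (rule path_pmf_nonempty)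
    then have "indicator {l. x \<notin> set (butlast l)} (y # l) * avoid_prob K x m y
      = indicator {l. x \<notin> set (butlast l)} l * (if y = x then 0 else avoid_prob K x m y)" for y
      by (auto simp: indicator_def)
    then show "(\<integral>\<^sup>+y. indicator {l. x \<notin> set (butlast l)} (y # l) * avoid_prob K x m y \<partial>K (hd l))
        = indicator {l. x \<notin> set (butlast l)} l * avoid_prob K x (Suc m) (hd l)"
      by (simp add: nn_integral_cmult)
  qed
  finally show ?case using Suc[of "Suc m"] by simp
qed

text \<open>
  For \<open>m = 0\<close> the left-hand side is 1, and the right-hand side splits this certain event according to the
  last visit to \<open>x\<close> up to time \<open>n\<close>, the first term standing for no visit after time 0. For general \<open>m\<close>
  the summands ask that no visit follows until time \<open>n + m\<close>.
\<close>

lemma last_exit_decomposition: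
  "(\<integral>\<^sup>+y. avoid_prob K x m y \<partial>step_law K n z)
    = avoid_prob K x (n + m) z + (\<Sum>j<n. ennreal (pmf (step_law K (Suc j) z) x) * avoid_prob K x (n + m - Suc j) x)"
proof (induction n arbitrary: m)
  case 0
  show ?case by (simp add: nn_integral_return_pmf)
next
  case (Suc n)
  have "(\<integral>\<^sup>+y. avoid_prob K x m y \<partial>step_law K (Suc n) z)
      = (\<integral>\<^sup>+y. (if y = x then 0 else avoid_prob K x m y) + indicator {x} y * avoid_prob K x m x \<partial>step_law K (Suc n) z)"
    by (intro nn_integral_cong) (auto simp: indicator_def)
  also have "\<dots> = (\<integral>\<^sup>+y. (if y = x then 0 else avoid_prob K x m y) \<partial>step_law K (Suc n) z)
      + ennreal (pmf (step_law K (Suc n) z) x) * avoid_prob K x m x"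
    by (subst nn_integral_add) (simp_all add: nn_integral_multc emeasure_pmf_single del: step_law.simps)
  also have "(\<integral>\<^sup>+y. (if y = x then 0 else avoid_prob K x m y) \<partial>step_law K (Suc n) z)
      = (\<integral>\<^sup>+y. avoid_prob K x (Suc m) y \<partial>step_law K n z)"
    by simp
  finally show ?case using Suc[of "Suc m"] by (simp add: add.assoc)
qed

text \<open>
  The sum is the mean return time to \<open>x\<close>. In the last exit decomposition at time \<open>N + J\<close>, the terms with
  a last visit after time \<open>J\<close> have total at least \<open>c\<close> times the \<open>N\<close>-th partial sum, and all terms
  together have total 1. So the mean return time is at most \<open>1 / c\<close>.
\<close>

lemma suminf_avoid_prob_finite:
  assumes c: "0 < c" and return: "\<And>j. j \<ge> J \<Longrightarrow> c \<le> pmf (step_law K j x) x"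
  shows "(\<Sum>n. avoid_prob K x n x) < \<infinity>"
proof -
  have "ennreal c * (\<Sum>i<N. avoid_prob K x i x) \<le> 1" for N
  proof -
    let ?n = "N + J"
    let ?t = "\<lambda>j. ennreal (pmf (step_law K (Suc j) x) x) * avoid_prob K x (?n - Suc j) x"
    have "ennreal c * (\<Sum>i<N. avoid_prob K x i x) = (\<Sum>i<N. ennreal c * avoid_prob K x i x)"
      by (simp add: sum_distrib_left)
    also have "\<dots> \<le> (\<Sum>i<N. ?t (?n - Suc i))"
    proof (intro sum_mono mult_mono)
      fix i assume "i \<in> {..<N}"
      then show "ennreal c \<le> ennreal (pmf (step_law K (Suc (?n - Suc i)) x) x)"
        "avoid_prob K x i x \<le> avoid_prob K x (?n - Suc (?n - Suc i)) x"
        by (auto intro!: ennreal_leI return simp del: step_law.simps)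
    qed auto
    also have "\<dots> = (\<Sum>j\<in>(\<lambda>i. ?n - Suc i) ` {..<N}. ?t j)"
      by (subst sum.reindex) (auto simp: inj_on_def)
    also have "\<dots> \<le> (\<Sum>j<?n. ?t j)"
      by (intro sum_mono2) auto
    also have "\<dots> \<le> avoid_prob K x ?n x + (\<Sum>j<?n. ?t j)"
      by simp
    also have "\<dots> = 1"
      using last_exit_decomposition[where K=K and x=x and m=0 and n="?n" and z=x] by (simp add: measure_pmf.emeasure_space_1 del: step_law.simps)
    finally show ?thesis .
  qed
  then have "(\<Sum>n. ennreal c * avoid_prob K x n x) \<le> 1"
    by (intro suminf_le_const) (auto simp: sum_distrib_left)
  then have "ennreal c * (\<Sum>n. avoid_prob K x n x) < \<infinity>"
    by (simp add: less_top[symmetric]) (metis ennreal_one_less_top leD top.not_eq_extremum)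
  then show ?thesis
    using c by (auto simp: ennreal_mult_less_top)
qed

text \<open>
  Let \<open>f\<close> be the positive part of \<open>p - q\<close>. Invariance gives \<open>f \<le> f K\<close>, and both sides have the same
  finite mass, so they are equal. If \<open>p \<noteq> q\<close>, then \<open>f\<close> is positive somewhere, hence \<open>f K\<close> is positive
  everywhere; but \<open>f\<close> vanishes where \<open>p < q\<close>.
\<close>

lemma invariant_pmf_unique:
  fixes p q :: "nat pmf"
  assumes pos: "\<And>x y. 0 < pmf (K x) y" and p: "bind_pmf p K = p" and q: "bind_pmf q K = q"
  shows "p = q"
proof (rule ccontr)
  assume neq: "p \<noteq> q"
  \<comment> \<open>Subtraction of extended nonnegative reals truncates at 0.\<close>
  define f where "f y = ennreal (pmf p y) - ennreal (pmf q y)" for y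
  define R where "R y = (\<integral>\<^sup>+x. f x * ennreal (pmf (K x) y) \<partial>count_space UNIV)" for y
  obtain x0 where x0: "pmf q x0 < pmf p x0" using pmf_neq_exists_less[of q p] neq by auto
  obtain y0 where y0: "pmf p y0 < pmf q y0" using pmf_neq_exists_less[of p q] neq by auto
  have f0: "f y0 = 0" using y0 by (simp add: f_def ennreal_minus ennreal_neg)
  have le: "f y \<le> R y" for y
  proof -
    have "ennreal (pmf p y) = (\<integral>\<^sup>+x. ennreal (pmf p x) * ennreal (pmf (K x) y) \<partial>count_space UNIV)"
      using ennreal_pmf_bind[of p K y] by (simp add: p nn_integral_measure_pmf)
    also have "\<dots> \<le> (\<integral>\<^sup>+x. f x * ennreal (pmf (K x) y) + ennreal (pmf q x) * ennreal (pmf (K x) y) \<partial>count_space UNIV)"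
      unfolding distrib_right[symmetric] f_def
    proof (intro nn_integral_mono mult_right_mono)
      show "ennreal (pmf p x) \<le> ennreal (pmf p x) - ennreal (pmf q x) + ennreal (pmf q x)" for x
        by (cases "pmf q x \<le> pmf p x")
           (auto simp: ennreal_minus ennreal_neg ennreal_leI simp flip: ennreal_plus)
    qed simp
    also have "\<dots> = R y + ennreal (pmf q y)"
      using ennreal_pmf_bind[of q K y] by (simp add: q R_def nn_integral_measure_pmf nn_integral_add)
    finally show ?thesis unfolding f_def
      by (simp add: ennreal_minus_le_iff add.commute)
  qed
  have "(\<integral>\<^sup>+y. f y \<partial>count_space UNIV) \<le> (\<integral>\<^sup>+y. ennreal (pmf p y) \<partial>count_space UNIV)"
    unfolding f_def by (intro nn_integral_mono diff_le_self_ennreal)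
  then have fin: "(\<integral>\<^sup>+y. f y \<partial>count_space UNIV) \<noteq> \<infinity>"
    by (auto simp: nn_integral_pmf measure_pmf.emeasure_space_1 top_unique)
  have "0 < f x0 * ennreal (pmf (K x0) y0)"
    using x0 pos[of x0 y0] by (simp add: f_def ennreal_minus ennreal_zero_less_mult_iff)
  also have "\<dots> \<le> R y0"
    unfolding R_def by (rule nn_integral_ge_point) simp
  finally have "f y0 < R y0" using f0 by simp
  then have "(\<integral>\<^sup>+y. f y \<partial>count_space UNIV) < (\<integral>\<^sup>+y. R y \<partial>count_space UNIV)"
    using le fin by (intro nn_integral_less) (auto simp: AE_count_space not_le)
  also have "\<dots> = (\<integral>\<^sup>+y. (\<Sum>x. f x * ennreal (pmf (K x) y)) \<partial>count_space UNIV)"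
    unfolding R_def by (subst (2) nn_integral_count_space_nat) simp
  also have "\<dots> = (\<Sum>x. f x * (\<integral>\<^sup>+y. ennreal (pmf (K x) y) \<partial>count_space UNIV))"
    by (subst nn_integral_suminf) (simp_all add: nn_integral_cmult)
  also have "\<dots> = (\<integral>\<^sup>+x. f x \<partial>count_space UNIV)"
    by (simp add: nn_integral_pmf measure_pmf.emeasure_space_1 nn_integral_count_space_nat)
  finally show False by simp
qed

section \<open>The annealed process as a Markov chain\<close>

text \<open>
  The summand at \<open>n\<close> says that there is no return up to time \<open>n\<close>, so the sum counts the times before
  the first return and is infinite if there is none.
\<close>

lemma return_time_le_suminf:
  "return_time X x \<le> (\<Sum>n. indicator {X. \<forall>j\<in>{1..n}. X j \<noteq> x} X)"
proof (cases "\<exists>n\<ge>1. X n = x")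
  case True
  define N where "N = (LEAST n. n \<ge> 1 \<and> X n = x)"
  have N: "N \<ge> 1 \<and> X N = x" unfolding N_def using True LeastI_ex[of "\<lambda>n. n \<ge> 1 \<and> X n = x"] by blast
  have before: "X j \<noteq> x" if "j \<ge> 1" "j < N" for j
    using not_less_Least[of j "\<lambda>n. n \<ge> 1 \<and> X n = x"] that by (auto simp: N_def)
  have "return_time X x \<le> of_nat N"
    unfolding return_time_def using N by (intro INF_lower) auto
  also have "\<dots> = (\<Sum>n<N. indicator {X. \<forall>j\<in>{1..n}. X j \<noteq> x} X)"
    using before by (auto simp: indicator_def)
  also have "\<dots> \<le> (\<Sum>n. indicator {X. \<forall>j\<in>{1..n}. X j \<noteq> x} X)"
    by (intro sum_le_suminf) auto
  finally show ?thesis .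
next
  case False
  have ge: "(of_nat N :: ennreal) \<le> (\<Sum>n. indicator {X. \<forall>j\<in>{1..n}. X j \<noteq> x} X)" for N
  proof -
    have "of_nat N = (\<Sum>n<N. indicator {X. \<forall>j\<in>{1..n}. X j \<noteq> x} X :: ennreal)"
      using False by (auto simp: indicator_def)
    also have "\<dots> \<le> (\<Sum>n. indicator {X. \<forall>j\<in>{1..n}. X j \<noteq> x} X)"
      by (intro sum_le_suminf) auto
    finally show ?thesis .
  qed
  have "(\<Sum>n. indicator {X. \<forall>j\<in>{1..n}. X j \<noteq> x} X) = (\<infinity> :: ennreal)"
    (is "?S = _")
  proof (rule ccontr)
    assume "?S \<noteq> \<infinity>"
    then obtain N where "?S < of_nat N"
      using ennreal_Ex_less_of_nat[of ?S] by (auto simp: less_top)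
    with ge[of N] show False by simp
  qed
  then show ?thesis by simp
qed

text \<open>
  The order of \<open>path_pmf\<close>: the most recent state comes first.
\<close>

definition history :: "(nat \<Rightarrow> 'a) \<Rightarrow> nat \<Rightarrow> 'a list" where
  "history X n = map X (rev [0..<Suc n])"

lemma history_Suc: "history X (Suc n) = X (Suc n) # history X n"
  by (simp add: history_def)

lemma history_eq_iff: "history X n = map w (rev [0..<Suc n]) \<longleftrightarrow> (\<forall>j\<le>n. X j = w j)"
  unfolding history_def by (auto simp: map_eq_conv)

lemma set_butlast_history: "set (butlast (history X n)) = X ` {1..n}"
proof -
  have "rev [0..<Suc n] = rev [1..<Suc n] @ [0]" by (simp add: upt_conv_Cons del: upt_Suc)
  then have "butlast (history X n) = map X (rev [1..<Suc n])"
    by (simp add: history_def butlast_append del: upt_Suc)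
  then show ?thesis by (simp add: atLeastLessThanSuc_atLeastAtMost del: upt_Suc)
qed

context env_marginal
begin

lemma measurable_history [measurable]:
  "(\<lambda>\<xi>. history (branching z \<xi>) n) \<in> annealed_law \<nu> \<rightarrow>\<^sub>M count_space UNIV"
  unfolding measurable_cong_sets[OF sets_annealed_law refl]
proof (induction n)
  case (Suc n)
  have "(\<lambda>\<xi>. y # history (branching z \<xi>) n) \<in> offspring_space \<rightarrow>\<^sub>M count_space UNIV" for y
    by (rule measurable_compose[OF Suc]) simp
  from measurable_compose_countable[OF this measurable_branching] show ?case
    unfolding history_Suc .
qed (simp add: history_def)

text \<open>
  Both sides give every list \<open>l\<close> the same mass: lists whose length is not \<open>n + 1\<close> have mass 0, and for
  the others the path formula for \<open>n + 1\<close> steps is the one for \<open>n\<close> steps times a transition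
  probability, which is the recursion for \<open>path_pmf\<close>.
\<close>

lemma distr_history:
  "distr (annealed_law \<nu>) (count_space UNIV) (\<lambda>\<xi>. history (branching z \<xi>) n) = measure_pmf (path_pmf K n z)"
proof -
  let ?E = "\<lambda>n l. {\<xi> \<in> space (annealed_law \<nu>). history (branching z \<xi>) n = l}"
  have len: "emeasure (annealed_law \<nu>) (?E n l) = 0" if "length l \<noteq> Suc n" for n l
  proof -
    have "?E n l = {}" using that by (auto simp: history_def)
    then show ?thesis by (simp only: emeasure_empty)
  qed
  have path: "emeasure (annealed_law \<nu>) (?E n (map w (rev [0..<Suc n])))
      = (if w 0 = z then \<Prod>j<n. ennreal (pmf (K (w j)) (w (Suc j))) else 0)" for n w
    unfolding history_eq_iff by (rule emeasure_annealed_path)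
  have "emeasure (annealed_law \<nu>) (?E n l) = pmf (path_pmf K n z) l" for n l
  proof (induction n arbitrary: l)
    case 0
    show ?case
    proof (cases "length l = 1")
      case True
      then obtain y where l: "l = [y]" by (cases l) auto
      show ?thesis using path[of 0 "\<lambda>_. y"] by (auto simp: l indicator_def)
    next
      case False
      then show ?thesis by (subst len) (auto simp: indicator_def)
    qed
  next
    case (Suc n)
    show ?case
    proof (cases "length l = Suc (Suc n)")
      case True
      define w where "w j = rev l ! j" for j
      have l: "l = map w (rev [0..<Suc (Suc n)])"
        using True unfolding w_def by (intro nth_equalityI) (auto simp: rev_nth rev_map simp del: upt_Suc)
      let ?l = "map w (rev [0..<Suc n])"
      have "emeasure (annealed_law \<nu>) (?E (Suc n) l)
          = emeasure (annealed_law \<nu>) (?E n ?l) * ennreal (pmf (K (w n)) (w (Suc n)))"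
        unfolding l path by simp
      also have "\<dots> = ennreal (pmf (path_pmf K n z) ?l * pmf (K (hd ?l)) (w (Suc n)))"
        unfolding Suc by (simp add: ennreal_mult)
      also have "\<dots> = ennreal (pmf (path_pmf K (Suc n) z) (w (Suc n) # ?l))"
        by (simp only: pmf_path_pmf_Cons)
      finally show ?thesis by (simp add: l)
    next
      case False
      show ?thesis
      proof (cases l)
        case (Cons y l')
        with False Suc[of l'] len[of l' n] show ?thesis
          by (subst len) (auto simp: pmf_path_pmf_Cons ennreal_eq_0_iff simp del: path_pmf.simps)
      next
        case Nil
        with path_pmf_nonempty[of "[]" K "Suc n" z] False show ?thesis
          by (subst len) (auto simp: pmf_eq_0_set_pmf simp del: path_pmf.simps)
      qed
    qed
  qed
  then show ?thesis
    by (intro measure_eqI_countable[of _ UNIV])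
       (simp_all add: emeasure_distr emeasure_pmf_single vimage_def Int_def conj_commute)
qed

lemma measure_annealed_branching:
  "measure (annealed_law \<nu>) {\<xi> \<in> space (annealed_law \<nu>). branching z \<xi> n = k} = pmf (step_law K n z) k"
proof -
  have hd: "hd (history (branching z \<xi>) n) = branching z \<xi> n" for \<xi>
    by (simp add: history_def)
  have "pmf (step_law K n z) k = measure (measure_pmf (path_pmf K n z)) (hd -` {k})"
    by (simp add: map_hd_path_pmf[symmetric] pmf_map)
  also have "\<dots> = measure (annealed_law \<nu>) {\<xi> \<in> space (annealed_law \<nu>). branching z \<xi> n = k}"
    by (subst distr_history[symmetric], subst measure_distr[OF measurable_history])
       (auto simp: hd intro!: arg_cong[where f="measure (annealed_law \<nu>)"])
  finally show ?thesis ..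
qed

lemma emeasure_annealed_avoid:
  "emeasure (annealed_law \<nu>) {\<xi> \<in> space (annealed_law \<nu>). \<forall>j\<in>{1..n}. branching z \<xi> j \<noteq> x} = avoid_prob K x n z"
proof -
  let ?L = "{l. x \<notin> set (butlast l)}"
  have "avoid_prob K x n z = emeasure (measure_pmf (path_pmf K n z)) ?L"
    using nn_integral_path_avoid[where K=K and x=x and m=0 and n=n and z=z] by simp
  also have "\<dots> = emeasure (annealed_law \<nu>) {\<xi> \<in> space (annealed_law \<nu>). \<forall>j\<in>{1..n}. branching z \<xi> j \<noteq> x}"
    by (subst distr_history[symmetric], subst emeasure_distr[OF measurable_history])
       (auto simp: set_butlast_history intro!: arg_cong[where f="emeasure (annealed_law \<nu>)"])
  finally show ?thesis ..
qed

lemma nn_integral_return_time_le: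
  "(\<integral>\<^sup>+\<xi>. return_time (branching z \<xi>) x \<partial>annealed_law \<nu>) \<le> (\<Sum>n. avoid_prob K x n z)"
proof -
  let ?A = "\<lambda>n. {\<xi> \<in> space (annealed_law \<nu>). \<forall>j\<in>{1..n}. branching z \<xi> j \<noteq> x}"
  have A: "?A n \<in> sets (annealed_law \<nu>)" for n
    unfolding space_annealed_law sets_annealed_law by measurable
  have "(\<integral>\<^sup>+\<xi>. return_time (branching z \<xi>) x \<partial>annealed_law \<nu>) \<le> (\<integral>\<^sup>+\<xi>. (\<Sum>n. indicator (?A n) \<xi>) \<partial>annealed_law \<nu>)"
  proof (rule nn_integral_mono)
    fix \<xi> assume \<xi>: "\<xi> \<in> space (annealed_law \<nu>)"
    have "indicator {X. \<forall>j\<in>{1..n}. X j \<noteq> x} (branching z \<xi>) = (indicator (?A n) \<xi> :: ennreal)" for n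
      using \<xi> by (simp add: indicator_def)
    with return_time_le_suminf[of "branching z \<xi>" x]
    show "return_time (branching z \<xi>) x \<le> (\<Sum>n. indicator (?A n) \<xi>)" by simp
  qed
  also have "\<dots> = (\<Sum>n. emeasure (annealed_law \<nu>) (?A n))"
    using A by (subst nn_integral_suminf) (auto intro!: suminf_cong)
  finally show ?thesis unfolding emeasure_annealed_avoid .
qed

end

section \<open>The stationary distribution\<close>

text \<open>
  The series in \<open>invariant_pmf\<close> always converges, its sum being a weight of \<open>bind_pmf p K\<close>.
\<close>

lemma invariant_pmf_iff_bind:
  assumes "\<And>x y. pmf (K x) y = Q x y"
  shows "invariant_pmf Q p \<longleftrightarrow> bind_pmf p K = p"
proof -
  have sums: "(\<lambda>x. pmf p x * Q x y) sums pmf (bind_pmf p K) y" for y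
  proof -
    have "(\<Sum>x. ennreal (pmf p x * Q x y)) = ennreal (pmf (bind_pmf p K) y)"
      by (simp add: ennreal_pmf_bind nn_integral_measure_pmf nn_integral_count_space_nat ennreal_mult flip: assms)
    moreover have "0 \<le> pmf p x * Q x y" for x by (simp flip: assms)
    ultimately show ?thesis
      by (intro sums_ennreal[THEN iffD1] sums_iff[THEN iffD2]) auto
  qed
  show ?thesis
    unfolding invariant_pmf_def pmf_eq_iff using sums sums_unique2 by metis
qed

lemma suminf_ennreal_geometric_less_top_iff: "(\<Sum>n. m ^ Suc n) < (\<infinity> :: ennreal) \<longleftrightarrow> m < 1"
proof
  assume "m < 1"
  then obtain r where r: "m = ennreal r" "0 \<le> r" "r < 1"
    by (cases m) (auto simp: ennreal_less_iff simp flip: ennreal_1)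
  then have "summable (\<lambda>n. r ^ Suc n)"
    by (subst summable_Suc_iff) (simp add: summable_geometric)
  then have "(\<Sum>n. ennreal (r ^ Suc n)) < \<infinity>"
    using r by (subst suminf_ennreal2) auto
  then show "(\<Sum>n. m ^ Suc n) < \<infinity>" using r by (simp add: ennreal_power del: power_Suc)
next
  assume fin: "(\<Sum>n. m ^ Suc n) < \<infinity>"
  show "m < 1"
  proof (rule ccontr)
    assume "\<not> m < 1"
    then have "1 \<le> m ^ Suc n" for n by (intro one_le_power) simp
    then have "(\<Sum>n. 1) \<le> (\<Sum>n. m ^ Suc n)" by (intro suminf_le) auto
    moreover have "(\<Sum>n. 1) = (\<infinity> :: ennreal)"
      using nn_integral_count_space_nat[of "\<lambda>_. 1"] by simp
    ultimately show False using fin by simp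
  qed
qed

context env_marginal
begin

text \<open>
  Each step of the chain puts its environment value in front of the earlier ones, which turns the \<open>n\<close>-th
  partial sum into the next one.
\<close>

lemma ennreal_pmf_step_law_0:
  "ennreal (pmf (step_law K n 0) k)
    = (\<integral>\<^sup>+\<eta>. ennreal (inverse (series_partial n \<eta>) * (1 - inverse (series_partial n \<eta>)) ^ k) \<partial>env_seq)"
proof (induction n arbitrary: k)
  case 0
  show ?case by (simp add: series_partial_def seq.P.emeasure_space_1 indicator_def power_0_left)
next
  case (Suc n)
  have "AE \<eta> in env_seq. 0 < inverse (series_partial n \<eta>) \<and> inverse (series_partial n \<eta>) \<le> 1"
    using series_partial_pos[of _ n] by (intro AE_I2) (force simp: inverse_le_1_iff)
  from bind_geometric_mixture_K[OF seq.P.prob_space_axioms _ this Suc, of k]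
  have "ennreal (pmf (step_law K (Suc n) 0) k)
    = (\<integral>\<^sup>+a. \<integral>\<^sup>+\<eta>. (let g = inverse (series_partial (Suc n) (case_nat a \<eta>)) in ennreal (g * (1 - g) ^ k)) \<partial>env_seq \<partial>\<nu>)"
    by (simp add: series_partial_case_nat odds_def)
  also have "\<dots> = (\<integral>\<^sup>+\<eta>. (let g = inverse (series_partial (Suc n) \<eta>) in ennreal (g * (1 - g) ^ k)) \<partial>env_seq)"
    unfolding Let_def by (rule nn_integral_env_seq[symmetric]) measurable
  finally show ?case unfolding Let_def .
qed

definition stationary :: "nat pmf" where
  "stationary = embed_pmf (\<lambda>k. \<integral>\<eta>. series_recip \<eta> * (1 - series_recip \<eta>) ^ k \<partial>env_seq)"

lemma geometric_weight_bounds: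
  fixes s :: real
  assumes "0 \<le> s" "s \<le> 1"
  shows "0 \<le> s * (1 - s) ^ k" "s * (1 - s) ^ k \<le> 1"
  using assms mult_mono[of s 1 "(1 - s) ^ k" 1] by (auto simp: power_le_one)

lemma integrable_series_recip: "integrable env_seq (\<lambda>\<eta>. series_recip \<eta> * (1 - series_recip \<eta>) ^ k)"
  using geometric_weight_bounds[OF series_recip_le_1]
  by (intro seq.P.integrable_const_bound[where B=1]) (auto simp: abs_of_nonneg)

lemma ennreal_integral_series_recip:
  "ennreal (\<integral>\<eta>. series_recip \<eta> * (1 - series_recip \<eta>) ^ k \<partial>env_seq)
    = (\<integral>\<^sup>+\<eta>. ennreal (series_recip \<eta> * (1 - series_recip \<eta>) ^ k) \<partial>env_seq)"
  by (rule nn_integral_eq_integral[OF integrable_series_recip, symmetric])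
     (simp add: geometric_weight_bounds series_recip_le_1)

context
  assumes fin: "AE \<eta> in env_seq. series_limit \<eta> < \<infinity>"
begin

lemma AE_series_recip_in_range: "AE \<eta> in env_seq. 0 < series_recip \<eta> \<and> series_recip \<eta> < 1"
  using fin AE_space
proof eventually_elim
  case (elim \<eta>)
  then show ?case by (simp add: series_recip_pos series_recip_less_1 space_env_seq)
qed

lemma pmf_stationary: "pmf stationary k = (\<integral>\<eta>. series_recip \<eta> * (1 - series_recip \<eta>) ^ k \<partial>env_seq)"
  unfolding stationary_def
proof (rule pmf_embed_pmf)
  show "0 \<le> (\<integral>\<eta>. series_recip \<eta> * (1 - series_recip \<eta>) ^ k \<partial>env_seq)" for k
    by (intro Bochner_Integration.integral_nonneg geometric_weight_bounds series_recip_le_1)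
  have "(\<integral>\<^sup>+k. ennreal (\<integral>\<eta>. series_recip \<eta> * (1 - series_recip \<eta>) ^ k \<partial>env_seq) \<partial>count_space UNIV)
      = (\<integral>\<^sup>+\<eta>. (\<Sum>k. ennreal (series_recip \<eta> * (1 - series_recip \<eta>) ^ k)) \<partial>env_seq)"
    unfolding ennreal_integral_series_recip nn_integral_count_space_nat
    by (rule nn_integral_suminf[symmetric]) measurable
  also have "\<dots> = (\<integral>\<^sup>+\<eta>. 1 \<partial>env_seq)"
  proof (rule nn_integral_cong_AE)
    show "AE \<eta> in env_seq. (\<Sum>k. ennreal (series_recip \<eta> * (1 - series_recip \<eta>) ^ k)) = 1"
      using AE_series_recip_in_range
    proof eventually_elim
      case (elim \<eta>)
      then have "(\<lambda>k. series_recip \<eta> * (1 - series_recip \<eta>) ^ k) sums (series_recip \<eta> * (1 / (1 - (1 - series_recip \<eta>))))"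
        by (intro sums_mult geometric_sums) simp
      with elim show ?case
        by (subst suminf_ennreal_eq) (auto simp: geometric_weight_bounds)
    qed
  qed
  finally show "(\<integral>\<^sup>+k. ennreal (\<integral>\<eta>. series_recip \<eta> * (1 - series_recip \<eta>) ^ k \<partial>env_seq) \<partial>count_space UNIV) = 1"
    by (simp add: seq.P.emeasure_space_1)
qed

lemma ennreal_pmf_stationary:
  "ennreal (pmf stationary k) = (\<integral>\<^sup>+\<eta>. ennreal (series_recip \<eta> * (1 - series_recip \<eta>) ^ k) \<partial>env_seq)"
  unfolding pmf_stationary by (rule ennreal_integral_series_recip)

text \<open>
  The chain step acts on the mixing parameter as the recursion \<open>1 / S = 1 + \<rho>\<^sub>1 / S'\<close>, and \<open>S\<close> and
  \<open>S'\<close> have the same law.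
\<close>

lemma bind_stationary_K: "bind_pmf stationary K = stationary"
proof (rule pmf_eqI)
  fix k
  have "AE \<eta> in env_seq. 0 < series_recip \<eta> \<and> series_recip \<eta> \<le> 1"
    using AE_series_recip_in_range by eventually_elim auto
  from bind_geometric_mixture_K[OF seq.P.prob_space_axioms _ this ennreal_pmf_stationary, of k]
  have "ennreal (pmf (bind_pmf stationary K) k)
    = (\<integral>\<^sup>+a. \<integral>\<^sup>+\<eta>. (let g = inverse (1 + (1 - a) / a * inverse (series_recip \<eta>)) in ennreal (g * (1 - g) ^ k)) \<partial>env_seq \<partial>\<nu>)"
    by simp
  also have "\<dots> = (\<integral>\<^sup>+a. \<integral>\<^sup>+\<eta>. (let g = series_recip (case_nat a \<eta>) in ennreal (g * (1 - g) ^ k)) \<partial>env_seq \<partial>\<nu>)"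
  proof (rule nn_integral_cong, rule nn_integral_cong_AE)
    fix a assume a: "a \<in> space \<nu>"
    show "AE \<eta> in env_seq. (let g = inverse (1 + (1 - a) / a * inverse (series_recip \<eta>)) in ennreal (g * (1 - g) ^ k))
        = (let g = series_recip (case_nat a \<eta>) in ennreal (g * (1 - g) ^ k))"
      using fin
    proof eventually_elim
      case (elim \<eta>)
      with a show ?case by (simp add: series_recip_case_nat space_marginal)
    qed
  qed
  also have "\<dots> = (\<integral>\<^sup>+\<eta>. (let g = series_recip \<eta> in ennreal (g * (1 - g) ^ k)) \<partial>env_seq)"
    unfolding Let_def by (rule nn_integral_env_seq[symmetric]) measurable
  finally show "pmf (bind_pmf stationary K) k = pmf stationary k"
    unfolding Let_def ennreal_pmf_stationary[symmetric] by simp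
qed

lemma step_law_0_tendsto: "(\<lambda>n. pmf (step_law K n 0) k) \<longlonglongrightarrow> pmf stationary k"
proof -
  let ?s = "\<lambda>n \<eta>. inverse (series_partial n \<eta>)"
  have s: "0 \<le> ?s n \<eta>" "?s n \<eta> \<le> 1" if "\<eta> \<in> space env_seq" for n \<eta>
    using series_partial_pos[OF that, of n] by (auto simp: inverse_le_1_iff)
  have bound: "AE \<eta> in env_seq. norm (?s n \<eta> * (1 - ?s n \<eta>) ^ k) \<le> 1" for n
    using geometric_weight_bounds[OF s] by (intro AE_I2) (simp add: abs_of_nonneg)
  have "ennreal (pmf (step_law K n 0) k) = ennreal (\<integral>\<eta>. ?s n \<eta> * (1 - ?s n \<eta>) ^ k \<partial>env_seq)" for n
    unfolding ennreal_pmf_step_law_0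
    using bound geometric_weight_bounds[OF s]
    by (intro nn_integral_eq_integral seq.P.integrable_const_bound[where B=1] AE_I2) auto
  then have "pmf (step_law K n 0) k = (\<integral>\<eta>. ?s n \<eta> * (1 - ?s n \<eta>) ^ k \<partial>env_seq)" for n
    using geometric_weight_bounds[OF s]
    by (subst (asm) ennreal_inj) (auto intro!: integral_nonneg_AE AE_I2)
  moreover have "(\<lambda>n. \<integral>\<eta>. ?s n \<eta> * (1 - ?s n \<eta>) ^ k \<partial>env_seq) \<longlonglongrightarrow> pmf stationary k"
    unfolding pmf_stationary
  proof (rule integral_dominated_convergence[where w="\<lambda>_. 1"])
    show "AE \<eta> in env_seq. (\<lambda>n. ?s n \<eta> * (1 - ?s n \<eta>) ^ k) \<longlonglongrightarrow> series_recip \<eta> * (1 - series_recip \<eta>) ^ k"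
      using fin AE_space
    proof eventually_elim
      case (elim \<eta>)
      from inverse_series_partial_tendsto[OF elim(2,1)] show ?case by (intro tendsto_intros)
    qed
  qed (use bound in simp_all)
  ultimately show ?thesis by simp
qed

lemma pmf_stationary_0_pos: "0 < pmf stationary 0"
proof -
  have "(\<integral>\<eta>. 0 \<partial>env_seq) < (\<integral>\<eta>. series_recip \<eta> * (1 - series_recip \<eta>) ^ 0 \<partial>env_seq)"
    using AE_series_recip_in_range
    by (intro seq.P.integral_less_AE_space integrable_series_recip) (auto simp: seq.P.emeasure_space_1)
  then show ?thesis by (simp add: pmf_stationary)
qed

text \<open>
  The partial sums increase to the series, so \<open>P(Z\<^sub>n = 0) = E S\<^sub>n\<close> never falls below \<open>E S\<close>.
\<close>

lemma step_law_0_0_ge: "pmf stationary 0 \<le> pmf (step_law K n 0) 0"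
proof -
  have "ennreal (pmf stationary 0) \<le> ennreal (pmf (step_law K n 0) 0)"
    unfolding ennreal_pmf_stationary ennreal_pmf_step_law_0
    using series_recip_le_inverse_series_partial[of _ n] by (intro nn_integral_mono) (simp add: ennreal_leI)
  then show ?thesis by simp
qed

lemma positive_recurrent_marginal: "positive_recurrent \<nu>"
  unfolding positive_recurrent_def
proof
  fix x
  \<comment> \<open>A return to \<open>x\<close> at time \<open>n + 2\<close> by a jump to 0, an excursion from 0 to 0 in \<open>n\<close> steps, and a
    jump back to \<open>x\<close>.\<close>
  let ?c = "pmf (K x) 0 * pmf stationary 0 * pmf (K 0) x"
  have "?c \<le> pmf (step_law K j x) x" if "2 \<le> j" for j
  proof -
    define n where "n = j - 2"
    with that have j: "j = Suc (Suc n)" by simp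
    have "?c \<le> pmf (K x) 0 * pmf (step_law K n 0) 0 * pmf (K 0) x"
      by (intro mult_right_mono mult_left_mono step_law_0_0_ge) auto
    also have "\<dots> \<le> pmf (step_law K (Suc n) x) 0 * pmf (K 0) x"
      unfolding step_law_Suc_left by (intro mult_right_mono pmf_bind_ge) auto
    also have "\<dots> \<le> pmf (step_law K j x) x"
      unfolding j step_law.simps(2)[of K "Suc n"] by (rule pmf_bind_ge)
    finally show ?thesis .
  qed
  moreover have "0 < ?c"
    by (intro mult_pos_pos pmf_stationary_0_pos) (simp_all add: pmf_K Q_kernel_pos)
  ultimately have "(\<Sum>n. avoid_prob K x n x) < \<infinity>"
    by (intro suminf_avoid_prob_finite[where J=2])
  with nn_integral_return_time_le[of x x]
  show "(\<integral>\<^sup>+\<xi>. return_time (branching x \<xi>) x \<partial>annealed_law \<nu>) < \<infinity>"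
    by (rule le_less_trans)
qed

text \<open>
  The mean of a geometric variable with parameter \<open>S\<close> is \<open>1 / S - 1\<close>. Adding 1 on both sides avoids this
  subtraction, and the possibly infinite expectation of \<open>1 / S\<close> is computed term by term.
\<close>

lemma mean_stationary:
  "(\<Sum>k. of_nat k * ennreal (pmf stationary k)) = (\<Sum>n. (\<integral>\<^sup>+a. ennreal (odds a) \<partial>\<nu>) ^ Suc n)"
proof -
  let ?m = "\<integral>\<^sup>+a. ennreal (odds a) \<partial>\<nu>"
  have "(\<Sum>k. of_nat k * ennreal (pmf stationary k)) + 1
      = (\<integral>\<^sup>+\<eta>. (\<Sum>k. of_nat k * ennreal (series_recip \<eta> * (1 - series_recip \<eta>) ^ k)) + 1 \<partial>env_seq)"
    unfolding ennreal_pmf_stationary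
    by (simp add: nn_integral_add nn_integral_suminf nn_integral_cmult seq.P.emeasure_space_1)
  also have "\<dots> = (\<integral>\<^sup>+\<eta>. series_limit \<eta> \<partial>env_seq)"
  proof (rule nn_integral_cong_AE)
    show "AE \<eta> in env_seq. (\<Sum>k. of_nat k * ennreal (series_recip \<eta> * (1 - series_recip \<eta>) ^ k)) + 1 = series_limit \<eta>"
      using fin
    proof eventually_elim
      case (elim \<eta>)
      then obtain v where v: "1 \<le> v" "series_limit \<eta> = ennreal v" "series_recip \<eta> = inverse v"
        by (rule series_limit_finiteE)
      let ?s = "inverse v"
      have s: "0 < ?s" "?s \<le> 1" using v by (auto simp: inverse_le_1_iff)
      have "(\<lambda>k. ?s * ((1 - ?s) ^ k * real k)) sums (?s * ((1 - ?s) / (1 - (1 - ?s))\<^sup>2))"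
        using s by (intro sums_mult geometric_sums_times_n) simp
      also have "?s * ((1 - ?s) / (1 - (1 - ?s))\<^sup>2) = v - 1"
        using v by (simp add: field_simps power2_eq_square)
      finally have "(\<Sum>k. ennreal (?s * ((1 - ?s) ^ k * real k))) = ennreal (v - 1)"
        using s by (intro suminf_ennreal_eq) auto
      moreover have "of_nat k * ennreal (?s * (1 - ?s) ^ k) = ennreal (?s * ((1 - ?s) ^ k * real k))" for k
        using s by (simp add: ennreal_of_nat_eq_real_of_nat ennreal_mult[symmetric] mult_ac)
      ultimately show ?case
        using v by (simp flip: ennreal_1 ennreal_plus)
    qed
  qed
  also have "\<dots> = (\<Sum>n. ?m ^ Suc n) + 1"
    unfolding nn_integral_series_limit
    using suminf_offset[of "\<lambda>n. ?m ^ n" 1] by (simp add: add.commute)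
  finally show ?thesis by (simp add: add.commute[of _ 1] ennreal_add_left_cancel del: power_Suc)
qed

end

end

theorem theorem4p5:
  fixes \<Theta> :: "(real ^ 'd) set"
    and \<nu> :: "real ^ 'd \<Rightarrow> real measure"
  assumes "compact \<Theta>"
    and "\<And>\<theta>. \<theta> \<in> \<Theta> \<Longrightarrow> distribution_01 (\<nu> \<theta>)"
    and "\<And>\<theta>. \<theta> \<in> \<Theta> \<Longrightarrow> integrable (env_law (\<nu> \<theta>)) (\<lambda>\<omega>. \<bar>ln (rho \<omega> 0)\<bar>)"
    and "\<And>\<theta>. \<theta> \<in> \<Theta> \<Longrightarrow> (\<integral>\<omega>. ln (rho \<omega> 0) \<partial>env_law (\<nu> \<theta>)) < 0"
  shows "\<forall>\<theta>\<in>\<Theta>.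
    positive_recurrent (\<nu> \<theta>) \<and>
    (\<exists>\<pi>.
      invariant_pmf (Q_kernel (\<nu> \<theta>)) \<pi> \<and>
      (\<forall>\<pi>'. invariant_pmf (Q_kernel (\<nu> \<theta>)) \<pi>' \<longrightarrow> \<pi>' = \<pi>) \<and>
      (\<forall>k. (\<lambda>n. measure (annealed_law (\<nu> \<theta>))
                  {\<xi> \<in> space (annealed_law (\<nu> \<theta>)). branching 0 \<xi> n = k})
             \<longlonglongrightarrow> pmf \<pi> k) \<and>
      (AE \<omega> in env_law (\<nu> \<theta>). 0 < S_env \<omega> \<and> S_env \<omega> < 1) \<and>
      (\<forall>k. pmf \<pi> k = (\<integral>\<omega>. S_env \<omega> * (1 - S_env \<omega>) ^ k \<partial>env_law (\<nu> \<theta>))) \<and>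
      (\<Sum>k. of_nat k * ennreal (pmf \<pi> k))
        = (\<Sum>n. (\<integral>\<^sup>+ \<omega>. ennreal (rho \<omega> 0) \<partial>env_law (\<nu> \<theta>)) ^ Suc n) \<and>
      ((\<Sum>k. of_nat k * ennreal (pmf \<pi> k)) < \<infinity>
        \<longleftrightarrow> (\<integral>\<^sup>+ \<omega>. ennreal (rho \<omega> 0) \<partial>env_law (\<nu> \<theta>)) < 1))"
proof
  fix \<theta> assume \<theta>: "\<theta> \<in> \<Theta>"
  interpret env_marginal "\<nu> \<theta>" using assms(2)[OF \<theta>] by unfold_locales
  let ?E = "env_law (\<nu> \<theta>)"
  have rho: "rho \<omega> 0 = odds (\<omega> 0)" for \<omega> by (simp add: rho_def odds_def)
  have comp: "(\<lambda>\<omega>. \<omega> 0) \<in> ?E \<rightarrow>\<^sub>M \<nu> \<theta>"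
    unfolding env_law_def by (rule measurable_component_singleton) simp
  have distr: "distr ?E (\<nu> \<theta>) (\<lambda>\<omega>. \<omega> 0) = \<nu> \<theta>"
    unfolding env_law_def by (rule distr_PiM_component[OF prob_space_marginal]) simp
  have shift: "(\<lambda>\<omega> n. \<omega> (int (Suc n))) \<in> ?E \<rightarrow>\<^sub>M env_seq"
    unfolding env_law_def by (rule measurable_PiM_single') (auto simp: space_PiM PiE_iff)
  have "integrable (\<nu> \<theta>) (\<lambda>a. \<bar>ln (odds a)\<bar>)"
    using assms(3)[OF \<theta>] integrable_distr_eq[OF comp, of "\<lambda>a. \<bar>ln (odds a)\<bar>"] by (simp add: rho distr)
  then have int: "integrable (\<nu> \<theta>) (\<lambda>a. ln (odds a))"
    by (simp add: integrable_abs_iff)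
  have drift: "(\<integral>a. ln (odds a) \<partial>\<nu> \<theta>) < 0"
    using assms(4)[OF \<theta>] integral_distr[OF comp, of "\<lambda>a. ln (odds a)"] by (simp add: rho distr)
  note fin = AE_series_limit_finite[OF int drift]
  have mean: "(\<integral>\<^sup>+\<omega>. ennreal (rho \<omega> 0) \<partial>?E) = (\<integral>\<^sup>+a. ennreal (odds a) \<partial>\<nu> \<theta>)"
    using nn_integral_distr[OF comp, of "\<lambda>a. ennreal (odds a)"] by (simp add: rho distr)
  have inv: "invariant_pmf (Q_kernel (\<nu> \<theta>)) p \<longleftrightarrow> bind_pmf p K = p" for p
    by (rule invariant_pmf_iff_bind[OF pmf_K])
  show "positive_recurrent (\<nu> \<theta>) \<and>
    (\<exists>\<pi>.
      invariant_pmf (Q_kernel (\<nu> \<theta>)) \<pi> \<and>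
      (\<forall>\<pi>'. invariant_pmf (Q_kernel (\<nu> \<theta>)) \<pi>' \<longrightarrow> \<pi>' = \<pi>) \<and>
      (\<forall>k. (\<lambda>n. measure (annealed_law (\<nu> \<theta>))
                  {\<xi> \<in> space (annealed_law (\<nu> \<theta>)). branching 0 \<xi> n = k})
             \<longlonglongrightarrow> pmf \<pi> k) \<and>
      (AE \<omega> in ?E. 0 < S_env \<omega> \<and> S_env \<omega> < 1) \<and>
      (\<forall>k. pmf \<pi> k = (\<integral>\<omega>. S_env \<omega> * (1 - S_env \<omega>) ^ k \<partial>?E)) \<and>
      (\<Sum>k. of_nat k * ennreal (pmf \<pi> k)) = (\<Sum>n. (\<integral>\<^sup>+ \<omega>. ennreal (rho \<omega> 0) \<partial>?E) ^ Suc n) \<and>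
      ((\<Sum>k. of_nat k * ennreal (pmf \<pi> k)) < \<infinity> \<longleftrightarrow> (\<integral>\<^sup>+ \<omega>. ennreal (rho \<omega> 0) \<partial>?E) < 1))"
  proof (intro conjI exI[of _ stationary] allI impI)
    show "positive_recurrent (\<nu> \<theta>)" by (rule positive_recurrent_marginal[OF fin])
    show "invariant_pmf (Q_kernel (\<nu> \<theta>)) stationary"
      unfolding inv by (rule bind_stationary_K[OF fin])
    show "\<pi>' = stationary" if "invariant_pmf (Q_kernel (\<nu> \<theta>)) \<pi>'" for \<pi>'
      using that unfolding inv
      by (rule invariant_pmf_unique[rotated, OF _ bind_stationary_K[OF fin]]) (simp_all add: pmf_K Q_kernel_pos)
    show "(\<lambda>n. measure (annealed_law (\<nu> \<theta>)) {\<xi> \<in> space (annealed_law (\<nu> \<theta>)). branching 0 \<xi> n = k})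
        \<longlonglongrightarrow> pmf stationary k" for k
      unfolding measure_annealed_branching by (rule step_law_0_tendsto[OF fin])
    show "AE \<omega> in ?E. 0 < S_env \<omega> \<and> S_env \<omega> < 1"
      unfolding S_env_eq_series_recip
      using AE_series_recip_in_range[OF fin]
      by (intro AE_distrD[OF shift]) (simp only: distr_env_law_shift)
    show "pmf stationary k = (\<integral>\<omega>. S_env \<omega> * (1 - S_env \<omega>) ^ k \<partial>?E)" for k
      unfolding S_env_eq_series_recip pmf_stationary[OF fin]
      by (subst distr_env_law_shift[symmetric], rule integral_distr[OF shift]) measurable
    show mean_eq: "(\<Sum>k. of_nat k * ennreal (pmf stationary k)) = (\<Sum>n. (\<integral>\<^sup>+ \<omega>. ennreal (rho \<omega> 0) \<partial>?E) ^ Suc n)"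
      unfolding mean by (rule mean_stationary[OF fin])
    show "(\<Sum>k. of_nat k * ennreal (pmf stationary k)) < \<infinity> \<longleftrightarrow> (\<integral>\<^sup>+ \<omega>. ennreal (rho \<omega> 0) \<partial>?E) < 1"
      unfolding mean_eq by (rule suminf_ennreal_geometric_less_top_iff)
  qed
qed

end
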